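(* Let $n\ge 1$ and $\mathcal{D}=\mathbb{C}[D_1,\dots,D_n]$. The $\mathcal{D}$-module $\mathcal{C}^\infty(\mathsf{PT})_{\mathsf{fin}}[x_1,\dots,x_n]$ is an injective envelope of its submodule $\mathcal{C}^\infty(\mathsf{PT})_{\mathsf{fin}}$. Similarly, $\mathcal{C}^\infty(\mathsf{T})_{\mathsf{fin}}[x_1,\dots,x_n]$ is an injective envelope of its submodule $\mathcal{C}^\infty(\mathsf{T})_{\mathsf{fin}}$ as a $\mathcal{D}$-module.
   Context: $\mathcal{D}=\mathbb{C}[D_1,\dots,D_n]$ is the commutative polynomial ring of constant coefficient differential operators on $\mathbb{R}^n$, with $D_j=\frac{1}{\imath}\frac{\partial}{\partial x_j}$, acting on smooth complex-valued functions on $\mathbb{R}^n$. With $\langle a,x\rangle=\sum_j a_jx_j$, $\mathcal{C}^\infty(\mathsf{PT})_{\mathsf{fin}}$ is the $\mathcal{D}$-module of finite sums $\sum_{a\in\mathbb{Q}^n}c_ae^{\imath\langle a,x\rangle}$, $c_a\in\mathbb{C}$, and $\mathcal{C}^\infty(\mathsf{T})_{\mathsf{fin}}$ is the $\mathcal{D}$-module of finite sums $\sum_{a\in\mathbb{Z}^n}c_ae^{\imath\langle a,x\rangle}$. The notation $[x_1,\dots,x_n]$ denotes the subalgebra of $\mathcal{C}^\infty(\mathbb{R}^n)$ obtained by adjoining the coordinate functions $x_1,\dots,x_n$. An injective envelope of a module $N$ is an injective module containing $N$ as an essential submodule. *)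

theory Defs
  imports "HOL-Analysis.Analysis" "HOL-Algebra.Module" "HOL-Library.Poly_Mapping"
begin

section \<open>Injective envelopes of modules\<close>

definition mod_homs ::
  "('r, 'z) ring_scheme \<Rightarrow> ('r, 'b, 'x) module_scheme \<Rightarrow> ('r, 'c, 'y) module_scheme \<Rightarrow> ('b \<Rightarrow> 'c) set"
  where "mod_homs R M N =
    {f \<in> hom (add_monoid M) (add_monoid N).
       \<forall>a\<in>carrier R. \<forall>x\<in>carrier M. f (a \<odot>\<^bsub>M\<^esub> x) = a \<odot>\<^bsub>N\<^esub> f x}"

text \<open>
  A definition cannot quantify over types, so the types of the elements of the test modules
  are parameters.  A theorem stated with type variables \<open>'b\<close> and \<open>'c\<close> in these places asserts
  the lifting property for all test modules over all types.
\<close>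

definition injective_module ::
  "'b itself \<Rightarrow> 'c itself \<Rightarrow> ('r, 'z) ring_scheme \<Rightarrow> ('r, 'e, 'x) module_scheme \<Rightarrow> bool"
  where "injective_module TYPE('b) TYPE('c) R E \<longleftrightarrow>
    Module.module R E \<and>
    (\<forall>(M :: ('r, 'b) module) (N :: ('r, 'c) module) i g.
       Module.module R M \<and> Module.module R N \<and>
       i \<in> mod_homs R M N \<and> inj_on i (carrier M) \<and> g \<in> mod_homs R M E \<longrightarrow>
       (\<exists>h \<in> mod_homs R N E. \<forall>x\<in>carrier M. h (i x) = g x))"

definition essential_submodule ::
  "'e set \<Rightarrow> ('r, 'z) ring_scheme \<Rightarrow> ('r, 'e, 'x) module_scheme \<Rightarrow> bool"
  where "essential_submodule N R E \<longleftrightarrow>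
    submodule N R E \<and>
    (\<forall>L. submodule L R E \<and> L \<noteq> {\<zero>\<^bsub>E\<^esub>} \<longrightarrow> L \<inter> N \<noteq> {\<zero>\<^bsub>E\<^esub>})"

definition injective_envelope ::
  "'b itself \<Rightarrow> 'c itself \<Rightarrow> ('r, 'z) ring_scheme \<Rightarrow> ('r, 'e, 'x) module_scheme \<Rightarrow> 'e set \<Rightarrow> bool"
  where "injective_envelope TYPE('b) TYPE('c) R E N \<longleftrightarrow>
    injective_module TYPE('b) TYPE('c) R E \<and> essential_submodule N R E"


section \<open>Constant coefficient differential operators on smooth functions\<close>

text \<open>
  A polynomial over \<open>\<complex>\<close> in the indeterminates \<open>D\<^sub>j\<close>, \<open>j :: 'n\<close>, is a finitely supported
  family of coefficients, indexed by exponent vectors \<open>'n \<Rightarrow>\<^sub>0 nat\<close>.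
  The operations of the type are addition and the convolution product.
\<close>

type_synonym 'n diff_op = "('n \<Rightarrow>\<^sub>0 nat) \<Rightarrow>\<^sub>0 complex"

definition diff_op_ring :: "'n diff_op ring"
  where "diff_op_ring = \<lparr>carrier = UNIV, mult = (*), one = 1, zero = 0, add = (+)\<rparr>"

definition D_op :: "'n \<Rightarrow> (real^'n \<Rightarrow> complex) \<Rightarrow> (real^'n \<Rightarrow> complex)"
  where "D_op j f = (\<lambda>x. 1 / \<i> * vector_derivative (\<lambda>t. f (x + t *\<^sub>R axis j 1)) (at 0))"

text \<open>
  A function is smooth iff it is differentiable everywhere and all its first order partial
  derivatives (here up to the factor \<open>1 / \<i>\<close>) are again smooth, where smoothness is the
  weakest property with this characteristic.
\<close>

coinductive_set smooth :: "(real^'n \<Rightarrow> complex) set"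
  where "\<lbrakk>\<forall>x. f differentiable (at x); \<forall>j. D_op j f \<in> smooth\<rbrakk> \<Longrightarrow> f \<in> smooth"

text \<open>
  \<open>D_monom m\<close> composes the powers \<open>D\<^sub>j ^ m\<^sub>j\<close> over all coordinates \<open>j\<close>.  The operators commute
  on smooth functions, where the result therefore does not depend on the order of composition.
\<close>

definition D_monom :: "('n \<Rightarrow>\<^sub>0 nat) \<Rightarrow> (real^'n \<Rightarrow> complex) \<Rightarrow> (real^'n \<Rightarrow> complex)"
  where "D_monom m f = Finite_Set.fold (\<lambda>j. D_op j ^^ Poly_Mapping.lookup m j) f UNIV"

definition D_act :: "'n diff_op \<Rightarrow> (real^'n \<Rightarrow> complex) \<Rightarrow> (real^'n \<Rightarrow> complex)"
  where "D_act P f = (\<lambda>x. \<Sum>m\<in>Poly_Mapping.keys P. Poly_Mapping.lookup P m * D_monom m f x)"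

definition smooth_module :: "('n diff_op, real^'n \<Rightarrow> complex) module"
  where "smooth_module =
    \<lparr>carrier = smooth, mult = (\<lambda>f g x. f x * g x), one = (\<lambda>x. 1),
     zero = (\<lambda>x. 0), add = (\<lambda>f g x. f x + g x), smult = D_act\<rparr>"


section \<open>Finite exponential sums and adjunction of the coordinate functions\<close>

definition fin_exp_sums :: "(real^'n) set \<Rightarrow> (real^'n \<Rightarrow> complex) set"
  where "fin_exp_sums \<Lambda> =
    {f. \<exists>A c. finite A \<and> A \<subseteq> \<Lambda> \<and>
          f = (\<lambda>x. \<Sum>a\<in>A. c a * exp (\<i> * complex_of_real (a \<bullet> x)))}"

definition PT_fin :: "(real^'n \<Rightarrow> complex) set"
  where "PT_fin = fin_exp_sums {a. \<forall>j. a $ j \<in> \<rat>}"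

definition T_fin :: "(real^'n \<Rightarrow> complex) set"
  where "T_fin = fin_exp_sums {a. \<forall>j. a $ j \<in> \<int>}"

definition smooth_subalgebra :: "(real^'n \<Rightarrow> complex) set \<Rightarrow> bool"
  where "smooth_subalgebra B \<longleftrightarrow>
    B \<subseteq> smooth \<and> (\<forall>c. (\<lambda>x. c) \<in> B) \<and>
    (\<forall>f\<in>B. \<forall>g\<in>B. (\<lambda>x. f x + g x) \<in> B \<and> (\<lambda>x. f x * g x) \<in> B)"

definition adjoin_coords :: "(real^'n \<Rightarrow> complex) set \<Rightarrow> (real^'n \<Rightarrow> complex) set"
  where "adjoin_coords A =
    smooth_subalgebra hull (A \<union> range (\<lambda>j x. complex_of_real (x $ j)))"

definition smooth_submodule ::
  "(real^'n \<Rightarrow> complex) set \<Rightarrow> ('n diff_op, real^'n \<Rightarrow> complex) module"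
  where "smooth_submodule A = smooth_module\<lparr>carrier := A\<rparr>"

end

theory Submission
  imports Defs "HOL-Computational_Algebra.Primes"
begin

text \<open>
  The module obtained by adjoining the coordinates consists of the exponential polynomials, the
  finite sums of terms \<open>x\<^sup>m exp (\<i> \<langle>a, x\<rangle>)\<close> whose frequencies \<open>a\<close> have all coordinates in \<open>S\<close>, where \<open>S\<close> is \<open>\<rat>\<close>
  or \<open>\<int>\<close>.  Every exponential polynomial is annihilated, for each \<open>j\<close>, by some product of factors
  \<open>D\<^sub>j - s\<close> with \<open>s \<in> S\<close>.  Hence every nonzero submodule contains a joint eigenvector of the \<open>D\<^sub>j\<close>,
  which is a multiple of a single exponential; this is essentiality.

  For injectivity take a maximal extension of a homomorphism into the exponential polynomials, and
  suppose that some \<open>y\<close> is not in its domain.  The operators \<open>P\<close> with \<open>P y\<close> in the domain form a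
  finitely generated ideal, so for each \<open>j\<close> one product \<open>d\<close> of factors \<open>D\<^sub>j - s\<close> kills all values
  at such \<open>P y\<close>; the homomorphism extends by zero to \<open>d\<^sup>k y\<close> for large \<open>k\<close>, whence \<open>d\<^sup>k y\<close> is in
  the domain by maximality.  So \<open>y\<close> has a multiple \<open>z\<close> outside the domain for which all
  \<open>(D\<^sub>j - a\<^sub>j) z\<close> lie in it, with \<open>a\<^sub>j \<in> S\<close>.  A value at \<open>z\<close> must solve the compatible system
  \<open>(D\<^sub>j - a\<^sub>j) f = g\<^sub>j\<close>, which is possible by the Poincare lemma after multiplication by the
  exponential of frequency \<open>- a\<close>, a contradiction.
\<close>

section \<open>Hilbert's basis theorem\<close>

text \<open>Induction on \<open>J\<close>. A finite \<open>B\<close> that works for the coordinates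
  in \<open>J\<close> also serves every \<open>a\<close> for which \<open>f a j\<close> is at least
  \<open>M\<close>, a bound for all \<open>f b j\<close> with \<open>b\<close> in \<open>B\<close>.
  What remains splits into the finitely many levels \<open>f a j = t\<close> with
  \<open>t < M\<close>, and each of them gets its own basis \<open>C t\<close>.\<close>

lemma dickson:
  fixes f :: "'a \<Rightarrow> 'j \<Rightarrow> nat"
  assumes "finite J"
  shows "\<exists>B\<subseteq>A. finite B \<and> (\<forall>a\<in>A. \<exists>b\<in>B. \<forall>j\<in>J. f b j \<le> f a j)"
  using assms
proof (induction J arbitrary: A)
  case empty
  show ?case
  proof (cases "A = {}")
    case False
    then obtain a where "a \<in> A" by blast
    then show ?thesis by (intro exI[of _ "{a}"]) auto
  qed auto
next
  case (insert j J)
  obtain B where B: "B \<subseteq> A" "finite B" "\<forall>a\<in>A. \<exists>b\<in>B. \<forall>i\<in>J. f b i \<le> f a i"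
    using insert.IH[of A] by blast
  have "\<exists>C. \<forall>t. C t \<subseteq> {a\<in>A. f a j = t} \<and> finite (C t) \<and>
      (\<forall>a\<in>{a\<in>A. f a j = t}. \<exists>b\<in>C t. \<forall>i\<in>J. f b i \<le> f a i)"
    using insert.IH by (intro choice) blast
  then obtain C where C0: "\<forall>t. C t \<subseteq> {a\<in>A. f a j = t} \<and> finite (C t) \<and>
      (\<forall>a\<in>{a\<in>A. f a j = t}. \<exists>b\<in>C t. \<forall>i\<in>J. f b i \<le> f a i)" ..
  have C: "C t \<subseteq> {a\<in>A. f a j = t}" "finite (C t)"
      "a \<in> A \<Longrightarrow> f a j = t \<Longrightarrow> \<exists>b\<in>C t. \<forall>i\<in>J. f b i \<le> f a i" for t a
    using C0[rule_format, of t] by auto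
  define M where "M = Max (insert 0 ((\<lambda>b. f b j) ` B))"
  have M: "f b j \<le> M" if "b \<in> B" for b
    unfolding M_def using B(2) that by simp
  show ?case
  proof (intro exI conjI ballI)
    show "B \<union> (\<Union>t<M. C t) \<subseteq> A" using B(1) C(1) by blast
    show "finite (B \<union> (\<Union>t<M. C t))" using B(2) C(2) by blast
    fix a assume a: "a \<in> A"
    show "\<exists>b\<in>B \<union> (\<Union>t<M. C t). \<forall>i\<in>insert j J. f b i \<le> f a i"
    proof (cases "f a j < M")
      case True
      obtain b where b: "b \<in> C (f a j)" "\<forall>i\<in>J. f b i \<le> f a i" using C(3) a by blast
      then have "f b j = f a j" using C(1) by blast
      then show ?thesis using b True by (intro bexI[of _ b]) auto
    next
      case False
      obtain b where b: "b \<in> B" "\<forall>i\<in>J. f b i \<le> f a i" using B(3) a by blast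
      then have "f b j \<le> f a j" using M[of b] False by linarith
      then show ?thesis using b by (intro bexI[of _ b]) auto
    qed
  qed
qed

text \<open>Unique factorisation: \<open>m \<mapsto> \<Prod>\<^sub>j p\<^sub>j ^ m\<^sub>j\<close> for distinct primes \<open>p\<^sub>j\<close> embeds the monomials into
  the positive integers, whose order thereby becomes a monomial order.\<close>

lemma ex_monomial_weight:
  "\<exists>w :: ('n::finite \<Rightarrow>\<^sub>0 nat) \<Rightarrow> nat.
     inj w \<and> (\<forall>k m. w (k + m) = w k * w m) \<and> (\<forall>m. 0 < w m)"
proof -
  obtain T :: "nat set" where T: "card T = CARD('n)" "finite T" "T \<subseteq> {p. prime p}"
    using infinite_arbitrarily_large[OF primes_infinite] by metis
  obtain p :: "'n \<Rightarrow> nat" where p: "bij_betw p UNIV T"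
    using finite_same_card_bij[of "UNIV :: 'n set" T] T by auto
  have pr: "prime (p j)" for j using p T by (auto simp: bij_betw_def)
  define w where "w m = (\<Prod>j\<in>UNIV. p j ^ Poly_Mapping.lookup m j)" for m :: "'n \<Rightarrow>\<^sub>0 nat"
  have mult: "multiplicity (p j) (w m) = Poly_Mapping.lookup m j" for m j
  proof -
    have "w m = (\<Prod>q\<in>T. q ^ Poly_Mapping.lookup m (inv_into UNIV p q))"
      unfolding w_def using p by (intro prod.reindex_bij_witness[of _ "inv_into UNIV p" p])
        (auto simp: bij_betw_def f_inv_into_f)
    moreover have "p j \<in> T" using p by (auto simp: bij_betw_def)
    moreover have "inv_into UNIV p (p j) = j" using p by (auto simp: bij_betw_def)
    ultimately show ?thesis
      using T pr[of j] multiplicity_prod_prime_powers[of T "p j" "\<lambda>q. Poly_Mapping.lookup m (inv_into UNIV p q)"]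
      by auto
  qed
  have "inj w"
    by (rule injI, rule poly_mapping_eqI) (metis mult)
  moreover have "w (k + m) = w k * w m" for k m
    by (simp add: w_def lookup_add power_add prod.distrib)
  moreover have "0 < w m" for m
    unfolding w_def using pr by (auto intro!: prod_pos simp: prime_gt_0_nat)
  ultimately show ?thesis by blast
qed

definition is_ideal :: "'a::comm_ring_1 set \<Rightarrow> bool" where
  "is_ideal I \<longleftrightarrow> 0 \<in> I \<and> (\<forall>x\<in>I. \<forall>y\<in>I. x + y \<in> I) \<and> (\<forall>r. \<forall>x\<in>I. r * x \<in> I)"

lemma is_ideal_diff: "is_ideal I \<Longrightarrow> x \<in> I \<Longrightarrow> y \<in> I \<Longrightarrow> x - y \<in> I"
  unfolding is_ideal_def by (metis diff_conv_add_uminus mult_minus1)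

lemma lookup_single_mult:
  fixes g :: "('n \<Rightarrow>\<^sub>0 nat) \<Rightarrow>\<^sub>0 'a::comm_ring_1"
  shows "Poly_Mapping.lookup (Poly_Mapping.single m c * g) (m + k) = c * Poly_Mapping.lookup g k"
  by (simp add: lookup_mult lookup_single when_mult)

text \<open>Division with remainder as for Groebner bases: by Dickson's lemma, finitely many
  elements \<open>G\<close> have leading monomials such that every leading monomial of
  \<open>I\<close> is divisible by one of them, and subtracting multiples of \<open>G\<close>
  reduces each element of \<open>I\<close> to zero. Generation is expressed by comparison with all
  ideals \<open>J\<close> containing \<open>G\<close>, the form in which it is applied
  later.\<close>

lemma hilbert_basis:
  fixes I :: "(('n::finite \<Rightarrow>\<^sub>0 nat) \<Rightarrow>\<^sub>0 'a::field) set"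
  assumes I: "is_ideal I"
  obtains G where "G \<subseteq> I" "finite G" "\<forall>J. is_ideal J \<longrightarrow> G \<subseteq> J \<longrightarrow> I \<subseteq> J"
proof -
  obtain w :: "('n \<Rightarrow>\<^sub>0 nat) \<Rightarrow> nat" where w: "inj w" "\<And>k m. w (k + m) = w k * w m" "\<And>m. 0 < w m"
    using ex_monomial_weight by blast
  have "\<exists>lm. \<forall>P::('n \<Rightarrow>\<^sub>0 nat) \<Rightarrow>\<^sub>0 'a. P \<noteq> 0 \<longrightarrow>
      lm P \<in> Poly_Mapping.keys P \<and> (\<forall>k\<in>Poly_Mapping.keys P. w k \<le> w (lm P))"
  proof (intro choice allI)
    fix P :: "('n \<Rightarrow>\<^sub>0 nat) \<Rightarrow>\<^sub>0 'a"
    show "\<exists>m. P \<noteq> 0 \<longrightarrow> m \<in> Poly_Mapping.keys P \<and> (\<forall>k\<in>Poly_Mapping.keys P. w k \<le> w m)"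
    proof (cases "P = 0")
      case False
      then have "Poly_Mapping.keys P \<noteq> {}" by simp
      then have "Max (w ` Poly_Mapping.keys P) \<in> w ` Poly_Mapping.keys P" by (intro Max_in) auto
      then obtain m where "m \<in> Poly_Mapping.keys P" "w m = Max (w ` Poly_Mapping.keys P)" by auto
      then show ?thesis by (intro exI[of _ m]) auto
    qed auto
  qed
  then obtain lm :: "(('n \<Rightarrow>\<^sub>0 nat) \<Rightarrow>\<^sub>0 'a) \<Rightarrow> ('n \<Rightarrow>\<^sub>0 nat)" where lm:
      "\<And>P. P \<noteq> 0 \<Longrightarrow> lm P \<in> Poly_Mapping.keys P"
      "\<And>P k. P \<noteq> 0 \<Longrightarrow> k \<in> Poly_Mapping.keys P \<Longrightarrow> w k \<le> w (lm P)"
    by metis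
  obtain B where B: "B \<subseteq> lm ` (I - {0})" "finite B"
      "\<And>a. a \<in> lm ` (I - {0}) \<Longrightarrow> \<exists>b\<in>B. \<forall>j. Poly_Mapping.lookup b j \<le> Poly_Mapping.lookup a j"
    using dickson[of UNIV "lm ` (I - {0})" Poly_Mapping.lookup] by auto
  obtain G where G: "G \<subseteq> I - {0}" "finite G" "B = lm ` G"
    using finite_subset_image[OF B(2,1)] by blast
  have "I \<subseteq> J" if J: "is_ideal J" "G \<subseteq> J" for J
  proof
    fix P assume "P \<in> I"
    then show "P \<in> J"
    \<comment> \<open>The zero polynomial gets the value 0, below that of every nonzero one because
      weights are positive.\<close>
    proof (induction "if P = 0 then 0 else w (lm P)" arbitrary: P rule: less_induct)
      case less
      show ?case
      proof (cases "P = 0")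
        case True
        then show ?thesis using J by (simp add: is_ideal_def)
      next
        case False
        then obtain b where "b \<in> B" and b: "\<forall>j. Poly_Mapping.lookup b j \<le> Poly_Mapping.lookup (lm P) j"
          using B(3) less.prems by blast
        then obtain g where g: "g \<in> G" "b = lm g" using G by blast
        then have g0: "g \<noteq> 0" "g \<in> I" "g \<in> J" using G J by auto
        define m where "m = lm P - b"
        have mb: "m + b = lm P"
          using b by (intro poly_mapping_eqI) (simp add: m_def lookup_add lookup_minus)
        \<comment> \<open>With this \<open>c\<close>, the monomial multiple \<open>Q\<close> of
          \<open>g\<close> has the same leading term as \<open>P\<close>, so the two cancel in
          \<open>P - Q\<close>.\<close>
        define c where "c = Poly_Mapping.lookup P (lm P) / Poly_Mapping.lookup g b"
        define Q where "Q = Poly_Mapping.single m c * g"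
        have nz: "Poly_Mapping.lookup g b \<noteq> 0"
          using lm(1)[OF g0(1)] g(2) by (simp add: in_keys_iff)
        have Q: "Q \<in> I" "Q \<in> J" using g0 I J by (auto simp: Q_def is_ideal_def)
        have top: "Poly_Mapping.lookup (P - Q) (lm P) = 0"
          using lookup_single_mult[of m c g b] nz
          by (simp add: lookup_minus mb Q_def c_def)
        have le: "w k \<le> w (lm P)" if "k \<in> Poly_Mapping.keys (P - Q)" for k
        proof -
          have "Poly_Mapping.lookup P k \<noteq> 0 \<or> Poly_Mapping.lookup Q k \<noteq> 0"
            using that by (auto simp: in_keys_iff lookup_minus)
          then show ?thesis
          proof
            assume "Poly_Mapping.lookup P k \<noteq> 0"
            then show ?thesis using lm(2)[OF False] by (simp add: in_keys_iff)
          next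
            assume "Poly_Mapping.lookup Q k \<noteq> 0"
            then have "k \<in> Poly_Mapping.keys Q" by (simp add: in_keys_iff)
            then have "k \<in> {a + b |a b. a \<in> Poly_Mapping.keys (Poly_Mapping.single m c) \<and> b \<in> Poly_Mapping.keys g}"
              unfolding Q_def using keys_mult by blast
            then obtain l where l: "l \<in> Poly_Mapping.keys g" "k = m + l"
              by (auto split: if_splits)
            then have "w k \<le> w m * w b"
              using lm(2)[OF g0(1) l(1)] g(2) w(2) by simp
            then show ?thesis using w(2) mb by metis
          qed
        qed
        have "(if P - Q = 0 then 0 else w (lm (P - Q))) < (if P = 0 then 0 else w (lm P))"
        proof (cases "P - Q = 0")
          case True
          then show ?thesis using False w(3) by simp
        next
          case nz': False
          \<comment> \<open>The weight does not increase by \<open>le\<close>; injectivity of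
            \<open>w\<close> makes the decrease strict.\<close>
          have "lm (P - Q) \<noteq> lm P" using lm(1)[OF nz'] top by (auto simp: in_keys_iff)
          then have "w (lm (P - Q)) \<noteq> w (lm P)" using w(1) by (auto dest: injD)
          then show ?thesis using le[OF lm(1)[OF nz']] False nz' by simp
        qed
        then have "P - Q \<in> J"
          using less.hyps[of "P - Q"] is_ideal_diff[OF I less.prems Q(1)] by blast
        then show ?thesis
          using J(1) Q(2) unfolding is_ideal_def by (metis diff_add_cancel)
      qed
    qed
  qed
  then show ?thesis using G by (intro that[of G]) auto
qed

section \<open>Generators of the ring of differential operators\<close>

definition Dvar :: "'n \<Rightarrow> 'n diff_op" where
  "Dvar j = Poly_Mapping.single (Poly_Mapping.single j 1) 1"

definition Dconst :: "complex \<Rightarrow> 'n diff_op" where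
  "Dconst c = Poly_Mapping.single 0 c"

lemma Dconst_simps:
  "Dconst 0 = 0" "Dconst 1 = 1" "Dconst (a + b) = Dconst a + Dconst b"
  "Dconst (a * b) = Dconst a * Dconst b" "Dconst (- a) = - Dconst a" "Dconst (a - b) = Dconst a - Dconst b"
  by (simp_all add: Dconst_def single_add mult_single single_uminus single_diff)

text \<open>An update at a fresh key is the addition of a \<open>single\<close>. The rule serves
  both for exponent vectors and for polynomials.\<close>

lemma poly_mapping_single_add_induct:
  assumes "Q 0" "\<And>k v. Q (Poly_Mapping.single k v)" "\<And>x y. Q x \<Longrightarrow> Q y \<Longrightarrow> Q (x + y)"
  shows "Q (p :: 'k \<Rightarrow>\<^sub>0 'v::comm_monoid_add)"
proof (induction p rule: update_induct)
  case const
  show ?case by (rule assms)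
next
  case (update f a b)
  have "Poly_Mapping.update a b f = f + Poly_Mapping.single a b"
    using update(1)
    by (intro poly_mapping_eqI) (auto simp: lookup_update lookup_add lookup_single in_keys_iff when_def)
  then show ?case using assms update by simp
qed

text \<open>Multiplication by a monomial is iterated multiplication by variables, by the preceding
  rule applied to the exponent vector; the same rule applied to the polynomial then yields all sums
  of monomials.\<close>

lemma diff_op_induct [case_names const var add]:
  fixes P :: "'n::finite diff_op"
  assumes const: "\<And>c. Q (Dconst c)" and var: "\<And>j P. Q P \<Longrightarrow> Q (Dvar j * P)"
    and add: "\<And>P R. Q P \<Longrightarrow> Q R \<Longrightarrow> Q (P + R)"
  shows "Q P"
proof -
  have monom: "Q P \<Longrightarrow> Q (Poly_Mapping.single m 1 * P)" for m P
  proof (induction m arbitrary: P rule: poly_mapping_single_add_induct)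
    case 1
    then show ?case by simp
  next
    case (2 j k)
    show ?case
    proof (induction k)
      case 0
      then show ?case using 2 by simp
    next
      case (Suc k)
      have "Poly_Mapping.single (Poly_Mapping.single j (Suc k)) 1 * P
         = Dvar j * (Poly_Mapping.single (Poly_Mapping.single j k) 1 * P)"
        by (simp add: Dvar_def mult_single mult.assoc [symmetric] flip: single_add)
      then show ?case using var[OF Suc.IH] by simp
    qed
  next
    case (3 x y)
    have "Poly_Mapping.single (x + y) 1 * P = Poly_Mapping.single x 1 * (Poly_Mapping.single y 1 * P)"
      by (simp add: mult_single mult.assoc [symmetric])
    then show ?case using 3 by simp
  qed
  have "Q (Poly_Mapping.single m c)" for m c
    using monom[OF const, of m c] by (simp add: Dconst_def mult_single)
  show ?thesis
  proof (induction P rule: poly_mapping_single_add_induct)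
    case 1
    show ?case using const[of 0] by (simp add: Dconst_simps)
  qed (use \<open>\<And>m c. Q (Poly_Mapping.single m c)\<close> add in auto)
qed

section \<open>Exponential polynomials\<close>

lemma D_op_works:
  assumes "f differentiable (at x)"
  shows "((\<lambda>t. f (x + t *\<^sub>R axis j 1)) has_vector_derivative (\<i> * D_op j f x)) (at 0)"
proof -
  \<comment> \<open>Total differentiability makes the restriction to the line differentiable, so
    that \<open>vector_derivative\<close> in \<open>D_op\<close> denotes an actual
    derivative.\<close>
  have "(f \<circ> (\<lambda>t. x + t *\<^sub>R axis j 1)) differentiable (at 0)"
    using assms by (intro differentiable_chain_at) auto
  then show ?thesis
    by (simp add: D_op_def o_def vector_derivative_works flip: vector_derivative_works)
qed

lemma D_opI:
  assumes "\<And>x. ((\<lambda>t. f (x + t *\<^sub>R axis j 1)) has_vector_derivative (\<i> * g x)) (at 0)"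
  shows "D_op j f = g"
  unfolding D_op_def by (rule ext) (simp add: vector_derivative_at[OF assms])

lemma D_op_add:
  assumes "\<And>x. f differentiable (at x)" "\<And>x. g differentiable (at x)"
  shows "D_op j (\<lambda>x. f x + g x) = (\<lambda>x. D_op j f x + D_op j g x)"
proof (rule D_opI)
  fix x
  show "((\<lambda>t. f (x + t *\<^sub>R axis j 1) + g (x + t *\<^sub>R axis j 1))
      has_vector_derivative \<i> * (D_op j f x + D_op j g x)) (at 0)"
    using has_vector_derivative_add[OF D_op_works[OF assms(1)] D_op_works[OF assms(2)], of x j x j]
    by (simp add: distrib_left)
qed

lemma D_op_mult:
  assumes "\<And>x. f differentiable (at x)" "\<And>x. g differentiable (at x)"
  shows "D_op j (\<lambda>x. f x * g x) = (\<lambda>x. f x * D_op j g x + D_op j f x * g x)"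
proof (rule D_opI)
  fix x
  show "((\<lambda>t. f (x + t *\<^sub>R axis j 1) * g (x + t *\<^sub>R axis j 1))
      has_vector_derivative \<i> * (f x * D_op j g x + D_op j f x * g x)) (at 0)"
    using has_vector_derivative_mult[OF D_op_works[OF assms(1)] D_op_works[OF assms(2)], of x j x j]
    by (simp add: algebra_simps)
qed

lemma D_op_const: "D_op j (\<lambda>x. c) = (\<lambda>x. 0)"
  by (rule D_opI) simp

lemma D_op_scale:
  assumes "\<And>x. f differentiable (at x)"
  shows "D_op j (\<lambda>x. c * f x) = (\<lambda>x. c * D_op j f x)"
  using D_op_mult[of "\<lambda>x. c" f j] assms by (simp add: D_op_const)

lemma D_op_coord: "D_op j (\<lambda>x. complex_of_real (x $ k)) = (\<lambda>x. if j = k then - \<i> else 0)"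
proof (rule D_opI)
  fix x
  show "((\<lambda>t. complex_of_real ((x + t *\<^sub>R axis j 1) $ k))
      has_vector_derivative \<i> * (if j = k then - \<i> else 0)) (at 0)"
    by (cases "j = k") (auto simp: axis_def intro!: derivative_eq_intros)
qed

section \<open>Characters and exponential polynomials\<close>

definition character :: "real^'n \<Rightarrow> real^'n \<Rightarrow> complex" where
  "character a x = exp (\<i> * complex_of_real (a \<bullet> x))"

lemma character_zero: "character 0 = (\<lambda>x. 1)"
  by (simp add: character_def fun_eq_iff)

lemma character_add: "character (a + b) x = character a x * character b x"
  by (simp add: character_def inner_add_left distrib_left exp_add)

lemma differentiable_coord: "(\<lambda>x. complex_of_real (x $ k)) differentiable (at (x :: real^'n))"
  by (rule differentiableI, rule bounded_linear_imp_has_derivative,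
      rule bounded_linear_compose[OF bounded_linear_of_real bounded_linear_vec_nth])

lemma differentiable_character: "character a differentiable (at x)"
proof -
  have "((\<lambda>x. \<i> * complex_of_real (a \<bullet> x)) has_derivative (\<lambda>h. \<i> * complex_of_real (a \<bullet> h))) (at x)"
    by (intro derivative_intros)
  from has_derivative_compose[OF this has_field_derivative_imp_has_derivative[OF DERIV_exp]]
  show ?thesis unfolding character_def [abs_def] differentiable_def by blast
qed

lemma D_op_character: "D_op j (character a) = (\<lambda>x. complex_of_real (a $ j) * character a x)"
proof (rule D_opI)
  fix x
  have "((\<lambda>t. \<i> * complex_of_real (a \<bullet> (x + t *\<^sub>R axis j 1)))
      has_vector_derivative \<i> * complex_of_real (a $ j)) (at 0)"
    by (auto simp: inner_add_right inner_axis intro!: derivative_eq_intros)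
  from field_vector_diff_chain_at[OF this DERIV_exp]
  show "((\<lambda>t. character a (x + t *\<^sub>R axis j 1))
      has_vector_derivative \<i> * (complex_of_real (a $ j) * character a x)) (at 0)"
    by (simp add: character_def o_def mult_ac)
qed

text \<open>The constructor \<open>coord\<close> multiplies by a single coordinate, so statements
  about derivatives reduce to the commutation of \<open>D_op j\<close> with one coordinate. Closure
  under arbitrary products is derived in \<open>exp_polys_mult\<close>.\<close>

inductive_set exp_polys :: "real set \<Rightarrow> (real^'n \<Rightarrow> complex) set" for S where
  character: "(\<And>j. a $ j \<in> S) \<Longrightarrow> character a \<in> exp_polys S"
| coord: "f \<in> exp_polys S \<Longrightarrow> (\<lambda>x. complex_of_real (x $ j) * f x) \<in> exp_polys S"
| add: "f \<in> exp_polys S \<Longrightarrow> g \<in> exp_polys S \<Longrightarrow> (\<lambda>x. f x + g x) \<in> exp_polys S"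
| scale: "f \<in> exp_polys S \<Longrightarrow> (\<lambda>x. c * f x) \<in> exp_polys S"

lemma exp_polys_differentiable:
  "f \<in> exp_polys S \<Longrightarrow> f differentiable (at x)"
  by (induction rule: exp_polys.induct)
    (auto intro!: differentiable_character differentiable_coord differentiable_mult differentiable_add)

lemma D_op_coord_mult:
  assumes "f \<in> exp_polys S"
  shows "D_op j (\<lambda>x. complex_of_real (x $ k) * f x) =
    (\<lambda>x. complex_of_real (x $ k) * D_op j f x + (if j = k then - \<i> else 0) * f x)"
  by (subst D_op_mult) (use assms in \<open>auto simp: D_op_coord differentiable_coord exp_polys_differentiable\<close>)

lemma D_op_exp_polys_add:
  "f \<in> exp_polys S \<Longrightarrow> g \<in> exp_polys S \<Longrightarrow> D_op j (\<lambda>x. f x + g x) = (\<lambda>x. D_op j f x + D_op j g x)"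
  by (intro D_op_add exp_polys_differentiable)

lemma D_op_exp_polys_scale:
  "f \<in> exp_polys S \<Longrightarrow> D_op j (\<lambda>x. c * f x) = (\<lambda>x. c * D_op j f x)"
  by (intro D_op_scale exp_polys_differentiable)

lemma D_op_closed: "f \<in> exp_polys S \<Longrightarrow> D_op j f \<in> exp_polys S"
proof (induction rule: exp_polys.induct)
  case (character a)
  then show ?case by (simp add: D_op_character exp_polys.intros)
next
  case (coord f k)
  show ?case unfolding D_op_coord_mult[OF coord.hyps] by (intro exp_polys.intros coord)
next
  case (add f g)
  then show ?case by (auto simp: D_op_exp_polys_add intro!: exp_polys.add)
next
  case (scale f c)
  then show ?case by (auto simp: D_op_exp_polys_scale intro!: exp_polys.scale)
qed

text \<open>Mixed derivatives are compared by structural induction on the explicit product rule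
  rather than by Schwarz's theorem. In the \<open>coord\<close> case both orders produce the same
  two cross terms.\<close>

lemma D_op_commute: "f \<in> exp_polys S \<Longrightarrow> D_op i (D_op j f) = D_op j (D_op i f)"
proof (induction rule: exp_polys.induct)
  case (character a)
  then have "character a \<in> exp_polys S" by (rule exp_polys.character)
  from D_op_exp_polys_scale[OF this] show ?case
    by (simp add: D_op_character mult.left_commute)
next
  case (coord f k)
  have *: "D_op i (\<lambda>x. complex_of_real (x $ k) * D_op j f x + c * f x)
    = (\<lambda>x. (complex_of_real (x $ k) * D_op i (D_op j f) x + (if i = k then - \<i> else 0) * D_op j f x)
          + c * D_op i f x)" for i j c
    unfolding D_op_exp_polys_add[OF exp_polys.coord[OF D_op_closed[OF coord.hyps]] exp_polys.scale[OF coord.hyps]]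
      D_op_coord_mult[OF D_op_closed[OF coord.hyps]] D_op_exp_polys_scale[OF coord.hyps] ..
  show ?case
    unfolding D_op_coord_mult[OF coord.hyps] * coord.IH by (simp add: fun_eq_iff)
next
  case (add f g)
  then show ?case by (simp add: D_op_exp_polys_add[where S=S] D_op_closed)
next
  case (scale f c)
  then show ?case by (simp add: D_op_exp_polys_scale[where S=S] D_op_closed)
qed

text \<open>By coinduction: the set consists of differentiable functions and is closed under every
  \<open>D_op j\<close>.\<close>

lemma exp_polys_smooth: "exp_polys S \<subseteq> smooth"
proof
  fix f :: "real^'n \<Rightarrow> complex" assume "f \<in> exp_polys S"
  then show "f \<in> smooth"
    by (coinduction arbitrary: f) (use exp_polys_differentiable D_op_closed in blast)
qed

section \<open>Monomial operators on exponential polynomials\<close>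

definition D_total :: "real set \<Rightarrow> 'n \<Rightarrow> (real^'n \<Rightarrow> complex) \<Rightarrow> (real^'n \<Rightarrow> complex)" where
  "D_total S j f = (if f \<in> exp_polys S then D_op j f else f)"

lemma D_total_commute: "D_total S i (D_total S j f) = D_total S j (D_total S i f)"
  by (auto simp: D_total_def D_op_closed D_op_commute)

lemma commute_funpow:
  assumes "\<And>x. f (g x) = g (f x)"
  shows "(f ^^ m) ((g ^^ n) x) = (g ^^ n) ((f ^^ m) x)"
proof -
  have 1: "f ((g ^^ n) x) = (g ^^ n) (f x)" for n x by (induction n) (auto simp: assms)
  show ?thesis by (induction m) (auto simp: 1)
qed

lemma D_total_funpow_commute:
  "(D_total S i ^^ m) ((D_total S j ^^ n) f) = (D_total S j ^^ n) ((D_total S i ^^ m) f)"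
  by (rule commute_funpow) (rule D_total_commute)

text \<open>The locale \<open>comp_fun_commute\<close> demands commutation on the whole type; this
  is why \<open>D_total\<close> is the identity off \<open>exp_polys S\<close>.\<close>

lemma D_total_comp_fun_commute: "comp_fun_commute (\<lambda>j. D_total S j ^^ m j)"
  by standard (auto simp: fun_eq_iff D_total_funpow_commute)

lemma D_op_funpow_closed: "f \<in> exp_polys S \<Longrightarrow> (D_op j ^^ k) f \<in> exp_polys S"
  by (induction k) (auto simp: D_op_closed)

lemma D_total_funpow: "f \<in> exp_polys S \<Longrightarrow> (D_total S j ^^ k) f = (D_op j ^^ k) f"
  by (induction k) (auto simp: D_total_def D_op_funpow_closed)

definition D_fold :: "real set \<Rightarrow> 'n set \<Rightarrow> ('n \<Rightarrow> nat) \<Rightarrow> (real^'n \<Rightarrow> complex) \<Rightarrow> (real^'n \<Rightarrow> complex)" where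
  "D_fold S A m f = Finite_Set.fold (\<lambda>j. D_total S j ^^ m j) f A"

lemma D_fold_empty [simp]: "D_fold S {} m f = f"
  by (simp add: D_fold_def)

lemma D_fold_insert [simp]:
  assumes "finite A" "j \<notin> A"
  shows "D_fold S (insert j A) m f = (D_total S j ^^ m j) (D_fold S A m f)"
proof -
  interpret comp_fun_commute "\<lambda>j. D_total S j ^^ m j" by (rule D_total_comp_fun_commute)
  show ?thesis using assms by (simp add: D_fold_def)
qed

text \<open>Off \<open>exp_polys S\<close> the \<open>D_op j\<close> need not commute, which would make the fold in \<open>D_monom\<close>
  meaningless; the fold never leaves \<open>exp_polys S\<close>, hence may be computed with commuting operators.\<close>

lemma D_monom_eq_D_fold:
  assumes "f \<in> exp_polys S"
  shows "D_monom m f = D_fold S UNIV (Poly_Mapping.lookup m) f"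
  unfolding D_monom_def D_fold_def
  by (rule Finite_Set.fold_closed_eq[where B="exp_polys S"])
    (auto simp: D_total_funpow D_op_funpow_closed assms)

lemma D_fold_closed:
  assumes "finite A" "f \<in> exp_polys S"
  shows "D_fold S A m f \<in> exp_polys S"
  using assms by (induction A rule: finite_induct) (auto simp: D_total_funpow D_op_funpow_closed)

lemma D_monom_closed: "f \<in> exp_polys S \<Longrightarrow> D_monom m f \<in> exp_polys S"
  by (simp add: D_monom_eq_D_fold D_fold_closed)

lemma D_op_funpow_add:
  assumes "f \<in> exp_polys S" "g \<in> exp_polys S"
  shows "(D_op j ^^ k) (\<lambda>x. f x + g x) = (\<lambda>x. (D_op j ^^ k) f x + (D_op j ^^ k) g x)"
  by (induction k) (auto simp: D_op_exp_polys_add[where S=S] D_op_funpow_closed assms)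

lemma D_op_funpow_scale:
  assumes "f \<in> exp_polys S"
  shows "(D_op j ^^ k) (\<lambda>x. c * f x) = (\<lambda>x. c * (D_op j ^^ k) f x)"
  by (induction k) (auto simp: D_op_exp_polys_scale[where S=S] D_op_funpow_closed assms)

lemma D_monom_add_right:
  assumes "f \<in> exp_polys S" "g \<in> exp_polys S"
  shows "D_monom m (\<lambda>x. f x + g x) = (\<lambda>x. D_monom m f x + D_monom m g x)"
proof -
  have "D_fold S A n (\<lambda>x. f x + g x) = (\<lambda>x. D_fold S A n f x + D_fold S A n g x)"
    if "finite A" for A n
    using that
    by (induction A rule: finite_induct)
      (auto simp: D_total_funpow D_op_funpow_add[where S=S] D_fold_closed exp_polys.add assms)
  then show ?thesis by (simp add: D_monom_eq_D_fold[where S=S] assms exp_polys.add)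
qed

lemma D_monom_scale:
  assumes "f \<in> exp_polys S"
  shows "D_monom m (\<lambda>x. c * f x) = (\<lambda>x. c * D_monom m f x)"
proof -
  have "D_fold S A n (\<lambda>x. c * f x) = (\<lambda>x. c * D_fold S A n f x)"
    if "finite A" for A n
    using that
    by (induction A rule: finite_induct)
      (auto simp: D_total_funpow D_op_funpow_scale[where S=S] D_fold_closed exp_polys.scale assms)
  then show ?thesis by (simp add: D_monom_eq_D_fold[where S=S] assms exp_polys.scale)
qed

lemma D_monom_plus:
  assumes "f \<in> exp_polys S"
  shows "D_monom (k + m) f = D_monom k (D_monom m f)"
proof -
  \<comment> \<open>Powers of one operator move inside the fold, which lets two folds be merged
    coordinate by coordinate.\<close>
  have left: "(D_total S j ^^ r) (D_fold S A n g) = D_fold S A n ((D_total S j ^^ r) g)"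
    if "finite A" for j r A n g
    using that
    by (induction A rule: finite_induct) (simp_all, metis D_total_funpow_commute)
  have "D_fold S A (\<lambda>j. p j + q j) g = D_fold S A p (D_fold S A q g)"
    if "finite A" for A p q g
    using that
    by (induction A rule: finite_induct) (simp_all add: left funpow_add)
  then show ?thesis
    by (simp add: D_monom_eq_D_fold[where S=S] assms D_fold_closed lookup_add[abs_def])
qed

lemma D_monom_single:
  assumes "f \<in> exp_polys S"
  shows "D_monom (Poly_Mapping.single j k) f = (D_op j ^^ k) f"
proof -
  have "D_fold S A (Poly_Mapping.lookup (Poly_Mapping.single j k)) f =
      (if j \<in> A then (D_op j ^^ k) f else f)" if "finite A" for A
    using that by (induction A rule: finite_induct)
      (auto simp: D_total_funpow D_op_funpow_closed lookup_single when_def assms)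
  then show ?thesis by (simp add: D_monom_eq_D_fold[where S=S] assms)
qed

lemma D_monom_zero: "f \<in> exp_polys S \<Longrightarrow> D_monom 0 f = f"
  using D_monom_single[of f S undefined 0] by simp

section \<open>Action of the operator ring and the module structure\<close>

lemma D_act_add_left: "D_act (P + Q) f = (\<lambda>x. D_act P f x + D_act Q f x)"
proof
  fix x
  let ?K = "Poly_Mapping.keys P \<union> Poly_Mapping.keys Q"
  have *: "D_act R f x = (\<Sum>m\<in>?K. Poly_Mapping.lookup R m * D_monom m f x)"
    if "Poly_Mapping.keys R \<subseteq> ?K" for R
    unfolding D_act_def using that by (intro sum.mono_neutral_left) (auto simp: in_keys_iff)
  show "D_act (P + Q) f x = D_act P f x + D_act Q f x"
    using Poly_Mapping.keys_add[of P Q]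
    by (simp add: * lookup_add distrib_right sum.distrib)
qed

lemma D_act_single: "D_act (Poly_Mapping.single m c) f = (\<lambda>x. c * D_monom m f x)"
  by (simp add: D_act_def)

lemma D_act_zero_left: "D_act 0 f = (\<lambda>x. 0)"
  by (simp add: D_act_def)

lemma diff_op_ring_cring: "cring (diff_op_ring :: 'n diff_op ring)"
proof (rule cringI)
  show "abelian_group (diff_op_ring :: 'n diff_op ring)"
    by (rule abelian_groupI) (auto simp: diff_op_ring_def add_ac intro: exI[of _ "- x" for x])
  show "comm_monoid (diff_op_ring :: 'n diff_op ring)"
    by (rule comm_monoidI) (auto simp: diff_op_ring_def mult_ac)
qed (auto simp: diff_op_ring_def distrib_right)

context
  fixes S :: "real set" assumes zero: "0 \<in> S"
begin

lemma exp_polys_const: "(\<lambda>x. c) \<in> exp_polys S"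
  using exp_polys.scale[OF exp_polys.character[of 0 S], of c] zero
  by (simp add: character_zero)

lemma D_act_closed: "f \<in> exp_polys S \<Longrightarrow> D_act P f \<in> exp_polys S"
  by (induction P rule: poly_mapping_single_add_induct)
    (auto simp: D_act_zero_left D_act_single D_act_add_left
      intro!: exp_polys_const exp_polys.add exp_polys.scale D_monom_closed)

lemma D_act_add_right:
  assumes "f \<in> exp_polys S" "g \<in> exp_polys S"
  shows "D_act P (\<lambda>x. f x + g x) = (\<lambda>x. D_act P f x + D_act P g x)"
  by (induction P rule: poly_mapping_single_add_induct)
    (auto simp: D_act_zero_left D_act_single D_act_add_left D_monom_add_right[OF assms] algebra_simps)

lemma D_act_scale:
  assumes "f \<in> exp_polys S"
  shows "D_act P (\<lambda>x. c * f x) = (\<lambda>x. c * D_act P f x)"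
  by (induction P rule: poly_mapping_single_add_induct)
    (auto simp: D_act_zero_left D_act_single D_act_add_left D_monom_scale[OF assms] algebra_simps)

text \<open>Both sides are additive in \<open>P\<close> and in \<open>Q\<close>, so two inductions
  reduce the claim to monomials, where it is \<open>D_monom_plus\<close>.\<close>

lemma D_act_mult:
  assumes "f \<in> exp_polys S"
  shows "D_act (P * Q) f = D_act P (D_act Q f)"
proof (induction P rule: poly_mapping_single_add_induct)
  case 1
  show ?case by (simp add: D_act_zero_left)
next
  case (2 k v)
  show ?case
  proof (induction Q rule: poly_mapping_single_add_induct)
    case 1
    show ?case using D_act_scale[OF assms, of _ 0] by (simp add: D_act_zero_left)
  next
    case (2 l u)
    show ?case
      by (simp add: mult_single D_act_single D_monom_plus[OF assms]
          D_monom_scale[OF D_monom_closed[OF assms]] mult_ac)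
  next
    case (3 x y)
    then show ?case
      by (simp add: distrib_left D_act_add_left D_act_add_right D_act_closed assms)
  qed
next
  case (3 x y)
  then show ?case by (simp add: distrib_right D_act_add_left)
qed

lemma D_act_Dconst: "f \<in> exp_polys S \<Longrightarrow> D_act (Dconst c) f = (\<lambda>x. c * f x)"
  by (simp add: Dconst_def D_act_single D_monom_zero)

lemma D_act_one: "f \<in> exp_polys S \<Longrightarrow> D_act 1 f = f"
  using D_act_Dconst[of f 1] by (simp add: Dconst_simps)

lemma D_act_Dvar: "f \<in> exp_polys S \<Longrightarrow> D_act (Dvar j) f = D_op j f"
  by (simp add: Dvar_def D_act_single D_monom_single)

lemma exp_polys_module:
  "Module.module diff_op_ring (smooth_submodule (exp_polys S) :: ('n diff_op, real^'n \<Rightarrow> complex) module)"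
proof (rule moduleI)
  show "cring (diff_op_ring :: 'n diff_op ring)"
    by (rule diff_op_ring_cring)
  show "abelian_group (smooth_submodule (exp_polys S) :: ('n diff_op, real^'n \<Rightarrow> complex) module)"
  proof (rule abelian_groupI)
    fix f assume "f \<in> carrier (smooth_submodule (exp_polys S) :: ('n diff_op, real^'n \<Rightarrow> complex) module)"
    then show "\<exists>g\<in>carrier (smooth_submodule (exp_polys S) :: ('n diff_op, real^'n \<Rightarrow> complex) module).
        g \<oplus>\<^bsub>smooth_submodule (exp_polys S)\<^esub> f = \<zero>\<^bsub>smooth_submodule (exp_polys S)\<^esub>"
      by (intro bexI[of _ "\<lambda>x. - 1 * f x"] exp_polys.scale[of f S "- 1"])
        (auto simp: smooth_submodule_def smooth_module_def exp_polys.scale[of f S "- 1", simplified])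
  qed (auto simp: smooth_submodule_def smooth_module_def exp_polys.add exp_polys_const add_ac)
qed (auto simp: smooth_submodule_def smooth_module_def diff_op_ring_def D_act_closed D_act_add_left
    D_act_add_right D_act_mult D_act_one)

end

section \<open>Linear factors, and functions determined by their derivatives\<close>

definition Dlin :: "'n \<Rightarrow> real \<Rightarrow> 'n diff_op" where
  "Dlin j r = Dvar j - Dconst (complex_of_real r)"

text \<open>The roots form a list, so that repeated roots are allowed and products of operators are
  concatenations.\<close>

definition Dlin_prod :: "'n \<Rightarrow> real list \<Rightarrow> 'n diff_op" where
  "Dlin_prod j rs = prod_list (map (Dlin j) rs)"

lemma Dlin_prod_simps [simp]:
  "Dlin_prod j [] = 1" "Dlin_prod j (r # rs) = Dlin j r * Dlin_prod j rs"
  "Dlin_prod j (rs @ ss) = Dlin_prod j rs * Dlin_prod j ss"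
  by (simp_all add: Dlin_prod_def)

text \<open>The partial derivatives are, up to the factor in \<open>D_op\<close>, the values of the
  total derivative at the axis vectors. Hence the total derivative vanishes, and convexity of the
  whole space gives constancy.\<close>

lemma D_op_zero_imp_const:
  assumes "\<And>x. f differentiable (at x)" and "\<And>j. D_op j f = (\<lambda>x. 0)"
  shows "\<exists>c. f = (\<lambda>x. c)"
proof -
  have "(f has_derivative (\<lambda>h. 0)) (at x within UNIV)" for x
  proof -
    obtain F where F: "(f has_derivative F) (at x)" using assms(1) by (auto simp: differentiable_def)
    interpret F: bounded_linear F using F by (rule has_derivative_bounded_linear)
    have ax: "F (axis j 1) = 0" for j
    proof -
      have "((\<lambda>t. x + t *\<^sub>R axis j 1) has_derivative (\<lambda>t. t *\<^sub>R axis j 1)) (at 0)"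
        by (auto intro!: derivative_eq_intros)
      from has_derivative_compose[OF this, of f F]
      have "((\<lambda>t. f (x + t *\<^sub>R axis j 1)) has_derivative (\<lambda>t. F (t *\<^sub>R axis j 1))) (at 0)"
        using F by simp
      then have "((\<lambda>t. f (x + t *\<^sub>R axis j 1)) has_vector_derivative F (axis j 1)) (at 0)"
        by (simp add: has_vector_derivative_def F.scaleR)
      from vector_derivative_unique_at[OF this D_op_works[OF assms(1)]] show ?thesis
        by (simp add: assms(2))
    qed
    have "F h = 0" for h
    proof -
      have "F h = F (\<Sum>j\<in>UNIV. h $ j *\<^sub>R axis j 1)"
        by (simp add: basis_expansion flip: scalar_mult_eq_scaleR)
      also have "\<dots> = 0" by (simp add: F.sum F.scaleR ax)
      finally show ?thesis .
    qed
    then have "F = (\<lambda>h. 0)" by blast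
    then show ?thesis using F by simp
  qed
  from has_derivative_zero_constant[OF convex_UNIV this] show ?thesis by auto
qed

text \<open>\<open>f\<close> is constant on every line parallel to the \<open>j\<close>-th axis, and
  each such line meets the hyperplane, at \<open>p\<close>.\<close>

lemma vanishing_on_hyperplane_imp_zero:
  assumes diff: "\<And>x. f differentiable (at x)" and "D_op j f = (\<lambda>x. 0)"
    and "\<And>x. x $ j = 0 \<Longrightarrow> f x = 0"
  shows "f = (\<lambda>x. 0)"
proof
  fix x :: "real^'a"
  define p where "p = x - x $ j *\<^sub>R axis j 1"
  have "((\<lambda>t. f (p + t *\<^sub>R axis j 1)) has_vector_derivative 0) (at t within UNIV)" for t
  proof -
    have "((\<lambda>s. s - t) has_vector_derivative 1) (at t)"
      by (auto intro!: derivative_eq_intros)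
    moreover have "((\<lambda>s. f ((p + t *\<^sub>R axis j 1) + s *\<^sub>R axis j 1)) has_vector_derivative 0) (at (t - t))"
      using D_op_works[OF diff, of "p + t *\<^sub>R axis j 1" j] assms(2) by simp
    ultimately have "((\<lambda>s. f ((p + t *\<^sub>R axis j 1) + s *\<^sub>R axis j 1)) \<circ> (\<lambda>s. s - t)
        has_vector_derivative 1 *\<^sub>R 0) (at t)"
      by (rule vector_diff_chain_at)
    then show ?thesis by (simp add: o_def algebra_simps)
  qed
  then obtain c where c: "\<And>t. f (p + t *\<^sub>R axis j 1) = c"
    using has_vector_derivative_zero_constant[OF convex_UNIV] by (metis UNIV_I)
  have "f p = 0" by (rule assms(3)) (simp add: p_def axis_def)
  then show "f x = 0" using c[of 0] c[of "x $ j"] by (simp add: p_def)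
qed

text \<open>An additive subgroup of the reals, to treat \<open>\<rat>\<close> and
  \<open>\<int>\<close> at once: \<open>0\<close> yields the constants, sums yield products of
  characters, and negatives yield the inverse character that moves a system to frequency
  zero.\<close>

locale frequencies =
  fixes S :: "real set"
  assumes zero: "0 \<in> S" and add: "r \<in> S \<Longrightarrow> s \<in> S \<Longrightarrow> r + s \<in> S" and minus: "r \<in> S \<Longrightarrow> - r \<in> S"
begin

section \<open>The algebra of exponential polynomials\<close>

lemma exp_polys_diff:
  "f \<in> exp_polys S \<Longrightarrow> g \<in> exp_polys S \<Longrightarrow> (\<lambda>x. f x - g x) \<in> exp_polys S"
  using exp_polys.add[of f S "\<lambda>x. - 1 * g x"] exp_polys.scale[of g S "- 1"] by simp

lemma D_op_diff:
  assumes "f \<in> exp_polys S" "g \<in> exp_polys S"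
  shows "D_op j (\<lambda>x. f x - g x) = (\<lambda>x. D_op j f x - D_op j g x)"
  using D_op_exp_polys_add[OF assms(1) exp_polys.scale[OF assms(2), of "- 1"], of j]
    D_op_exp_polys_scale[OF assms(2), of j "- 1"] by simp

text \<open>The other constructors are compatible with multiplication by a fixed function, so one
  induction reduces \<open>f\<close> to a character and an inner one reduces \<open>g\<close>; for
  two characters the frequencies add.\<close>

lemma exp_polys_mult:
  assumes "f \<in> exp_polys S" "g \<in> exp_polys S"
  shows "(\<lambda>x. f x * g x) \<in> exp_polys S"
  using assms
proof (induction f rule: exp_polys.induct)
  case (character a)
  from character(2) show ?case
  proof (induction g rule: exp_polys.induct)
    case (character b)
    have "character (a + b) \<in> exp_polys S"
      using character \<open>\<And>j. a $ j \<in> S\<close> by (intro exp_polys.character) (simp add: add)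
    then show ?case by (simp add: character_add[abs_def])
  next
    case (coord f j)
    then show ?case using exp_polys.coord[OF coord.IH, of j] by (simp add: mult_ac)
  next
    case (add f g)
    then show ?case using exp_polys.add[OF add.IH] by (simp add: distrib_left)
  next
    case (scale f c)
    then show ?case using exp_polys.scale[OF scale.IH, of c] by (simp add: mult_ac)
  qed
next
  case (coord f j)
  then show ?case using exp_polys.coord[OF coord.IH, of j] by (simp add: mult_ac)
next
  case (add f g)
  then show ?case using exp_polys.add[OF add.IH] by (simp add: distrib_right)
next
  case (scale f c)
  then show ?case using exp_polys.scale[OF scale.IH, of c] by (simp add: mult_ac)
qed

lemma fin_exp_sums_subset_exp_polys: "fin_exp_sums {a. \<forall>j. a $ j \<in> S} \<subseteq> exp_polys S"
proof -
  have "(\<lambda>x. \<Sum>a\<in>A. c a * character a x) \<in> exp_polys S"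
    if "finite A" "A \<subseteq> {a. \<forall>j. a $ j \<in> S}" for A c
    using that
    by (induction A rule: finite_induct)
      (auto intro!: exp_polys_const zero exp_polys.add exp_polys.scale exp_polys.character)
  then show ?thesis
    by (fastforce simp: fin_exp_sums_def character_def)
qed

lemma character_in_fin_exp_sums:
  assumes "\<And>j. a $ j \<in> S"
  shows "(\<lambda>x. c * character a x) \<in> fin_exp_sums {a. \<forall>j. a $ j \<in> S}"
  unfolding fin_exp_sums_def character_def using assms
  by (intro CollectI exI[of _ "{a}"] exI[of _ "\<lambda>_. c"]) auto

text \<open>The exponential polynomials form a smooth subalgebra containing the generators, hence
  contain the hull. Conversely every constructor is available in any such subalgebra, scalar
  multiples because it contains the constants.\<close>

lemma adjoin_coords_fin_exp_sums:
  "adjoin_coords (fin_exp_sums {a :: real^'n. \<forall>j. a $ j \<in> S}) = exp_polys S"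
    (is "adjoin_coords ?N = ?E")
proof
  have "range (\<lambda>j x. complex_of_real (x $ j)) \<subseteq> ?E"
    using exp_polys.coord[OF exp_polys_const[OF zero, of 1]] by auto
  then show "adjoin_coords ?N \<subseteq> ?E"
    unfolding adjoin_coords_def using fin_exp_sums_subset_exp_polys
    by (intro hull_minimal)
      (auto simp: smooth_subalgebra_def exp_polys_const[OF zero] exp_polys_mult exp_polys.add
        subsetD[OF exp_polys_smooth])
  show "?E \<subseteq> adjoin_coords ?N"
    unfolding adjoin_coords_def hull_def
  proof (intro Inter_greatest subsetI)
    fix B f
    assume "B \<in> {B. smooth_subalgebra B \<and> ?N \<union> range (\<lambda>j x. complex_of_real (x $ j)) \<subseteq> B}"
    then have B: "smooth_subalgebra B" "?N \<subseteq> B"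
        "\<And>j. (\<lambda>x. complex_of_real (x $ j)) \<in> B"
      by auto
    assume "f \<in> ?E"
    then show "f \<in> B"
    proof (induction rule: exp_polys.induct)
      case (character a)
      then show ?case using B(2) character_in_fin_exp_sums[of a 1] by auto
    qed (use B in \<open>auto simp: smooth_subalgebra_def\<close>)
  qed
qed

section \<open>Torsion and joint eigenfunctions\<close>

lemma D_act_Dlin:
  assumes "f \<in> exp_polys S"
  shows "D_act (Dlin j r) f = (\<lambda>x. D_op j f x - complex_of_real r * f x)"
  using D_act_add_left[of "Dlin j r" "Dconst (complex_of_real r)" f] assms
  by (simp add: Dlin_def D_act_Dvar[OF zero] D_act_Dconst[OF zero] fun_eq_iff)

lemma D_act_zero_right: "D_act P (\<lambda>x. 0) = (\<lambda>x. 0)"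
  using D_act_scale[OF zero exp_polys_const[OF zero, of 0], of P 0] by simp

text \<open>The commutator of a constant coefficient operator with multiplication by
  \<open>x $ k\<close> is again such an operator. The torsion argument exploits that
  \<open>W\<close>, as an element of the commutative ring, commutes with
  \<open>Dlin_prod j rs\<close>.\<close>

lemma D_act_Dlin_prod_coord:
  assumes f: "f \<in> exp_polys S"
  shows "\<exists>W. D_act (Dlin_prod j rs) (\<lambda>x. complex_of_real (x $ k) * f x) =
    (\<lambda>x. complex_of_real (x $ k) * D_act (Dlin_prod j rs) f x + D_act W f x)"
proof (induction rs)
  case Nil
  show ?case
    by (intro exI[of _ 0]) (simp add: D_act_one[OF zero] f exp_polys.coord D_act_zero_left)
next
  case (Cons r rs)
  then obtain W where W: "D_act (Dlin_prod j rs) (\<lambda>x. complex_of_real (x $ k) * f x) =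
    (\<lambda>x. complex_of_real (x $ k) * D_act (Dlin_prod j rs) f x + D_act W f x)" by blast
  let ?g = "D_act (Dlin_prod j rs) f" and ?c = "if j = k then - \<i> else 0"
  have g: "?g \<in> exp_polys S" and Wf: "D_act W f \<in> exp_polys S"
    using f D_act_closed[OF zero] by auto
  have "D_act (Dlin_prod j (r # rs)) (\<lambda>x. complex_of_real (x $ k) * f x) =
      D_act (Dlin j r) (\<lambda>x. complex_of_real (x $ k) * ?g x + D_act W f x)"
    by (simp add: D_act_mult[OF zero] exp_polys.coord f W)
  also have "\<dots> = (\<lambda>x. D_act (Dlin j r) (\<lambda>x. complex_of_real (x $ k) * ?g x) x + D_act (Dlin j r) (D_act W f) x)"
    by (intro D_act_add_right[OF zero] exp_polys.coord g Wf)
  also have "D_act (Dlin j r) (\<lambda>x. complex_of_real (x $ k) * ?g x) =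
      (\<lambda>x. complex_of_real (x $ k) * D_act (Dlin j r) ?g x + ?c * ?g x)"
    unfolding D_act_Dlin[OF exp_polys.coord[OF g]] D_act_Dlin[OF g] D_op_coord_mult[OF g]
    by (simp add: algebra_simps)
  \<comment> \<open>Commutators obey a product rule: the one for \<open>r # rs\<close> is the
    constant \<open>?c\<close> times the remaining product, plus
    \<open>Dlin j r * W\<close>.\<close>
  finally have "D_act (Dlin_prod j (r # rs)) (\<lambda>x. complex_of_real (x $ k) * f x) =
      (\<lambda>x. complex_of_real (x $ k) * D_act (Dlin_prod j (r # rs)) f x
        + D_act (Dconst ?c * Dlin_prod j rs + Dlin j r * W) f x)"
    unfolding Dlin_prod_simps D_act_mult[OF zero f] D_act_add_left D_act_Dconst[OF zero g]
    by (simp only: add.assoc)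
  then show ?case by blast
qed

text \<open>One factor kills a character. In the \<open>coord\<close> case a product killing
  \<open>f\<close> leaves only the commutator term \<open>D_act W f\<close>, and a second copy of it
  kills that term, hence \<open>rs @ rs\<close>. For a sum the two lists are concatenated.\<close>

lemma exp_polys_torsion:
  assumes "f \<in> exp_polys S"
  shows "\<exists>rs. set rs \<subseteq> S \<and> D_act (Dlin_prod j rs) f = (\<lambda>x. 0)"
  using assms
proof (induction rule: exp_polys.induct)
  case (character a)
  then show ?case
    by (intro exI[of _ "[a $ j]"]) (simp add: D_act_Dlin exp_polys.character D_op_character)
next
  case (coord f k)
  then obtain rs where rs: "set rs \<subseteq> S" "D_act (Dlin_prod j rs) f = (\<lambda>x. 0)" by blast
  obtain W where W: "D_act (Dlin_prod j rs) (\<lambda>x. complex_of_real (x $ k) * f x) =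
    (\<lambda>x. complex_of_real (x $ k) * D_act (Dlin_prod j rs) f x + D_act W f x)"
    using D_act_Dlin_prod_coord[OF coord.hyps] by blast
  have "D_act (Dlin_prod j rs) (D_act W f) = D_act W (D_act (Dlin_prod j rs) f)"
    by (metis D_act_mult[OF zero coord.hyps] mult.commute)
  then show ?case
    using rs W coord.hyps
    by (intro exI[of _ "rs @ rs"]) (simp add: D_act_mult[OF zero] exp_polys.coord D_act_zero_right)
next
  case (add f g)
  then obtain rs ss where rs: "set rs \<subseteq> S" "D_act (Dlin_prod j rs) f = (\<lambda>x. 0)"
    and ss: "set ss \<subseteq> S" "D_act (Dlin_prod j ss) g = (\<lambda>x. 0)" by blast
  have "D_act (Dlin_prod j rs * Dlin_prod j ss) f = (\<lambda>x. 0)"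
    using rs add.hyps by (subst mult.commute) (simp add: D_act_mult[OF zero] D_act_zero_right)
  moreover have "D_act (Dlin_prod j rs * Dlin_prod j ss) g = (\<lambda>x. 0)"
    using ss add.hyps by (simp add: D_act_mult[OF zero] D_act_zero_right)
  ultimately show ?case
    using rs ss add.hyps
    by (intro exI[of _ "rs @ ss"]) (simp add: D_act_add_right[OF zero])
next
  case (scale f c)
  then obtain rs where "set rs \<subseteq> S" "D_act (Dlin_prod j rs) f = (\<lambda>x. 0)" by blast
  then show ?case
    using scale.hyps by (intro exI[of _ rs]) (simp add: D_act_scale[OF zero])
qed

lemma character_mult_closed:
  "(\<And>j. a $ j \<in> S) \<Longrightarrow> f \<in> exp_polys S \<Longrightarrow> (\<lambda>x. character a x * f x) \<in> exp_polys S"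
  by (intro exp_polys_mult exp_polys.character)

lemma character_minus: "character a x * character (- a) x = 1"
  by (simp add: character_zero flip: character_add)

lemma D_op_character_mult:
  assumes "f \<in> exp_polys S"
  shows "D_op j (\<lambda>x. character a x * f x) =
    (\<lambda>x. character a x * (D_op j f x + complex_of_real (a $ j) * f x))"
  by (subst D_op_mult)
    (use assms in \<open>auto simp: D_op_character differentiable_character exp_polys_differentiable algebra_simps\<close>)

text \<open>Multiplication by \<open>character (- a)\<close> turns \<open>D_op j\<close> minus
  \<open>a $ j\<close> into \<open>D_op j\<close>, so the twisted function \<open>g\<close> has
  vanishing derivatives and is constant.\<close>

lemma joint_eigenfunction:
  assumes f: "f \<in> exp_polys S" and a: "\<And>j. a $ j \<in> S"
    and eig: "\<And>j. D_act (Dlin j (a $ j)) f = (\<lambda>x. 0)"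
  shows "\<exists>c. f = (\<lambda>x. c * character a x)"
proof -
  define g where "g x = character (- a) x * f x" for x
  have g: "g \<in> exp_polys S"
    unfolding g_def using f a minus by (intro character_mult_closed) auto
  have "D_op j g = (\<lambda>x. 0)" for j
    unfolding g_def D_op_character_mult[OF f]
    using eig[of j] by (simp add: D_act_Dlin[OF f] fun_eq_iff)
  then obtain c where "g = (\<lambda>x. c)"
    using D_op_zero_imp_const exp_polys_differentiable[OF g] by blast
  moreover have "f x = character a x * g x" for x
    using character_minus[of a x] by (simp add: g_def mult.assoc [symmetric])
  ultimately have "f = (\<lambda>x. c * character a x)" by (simp add: fun_eq_iff)
  then show ?thesis by blast
qed

section \<open>Antiderivatives and the Poincare lemma\<close>

lemma D_op_funpow_coord_mult:
  assumes "f \<in> exp_polys S"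
  shows "(D_op j ^^ Suc n) (\<lambda>x. complex_of_real (x $ k) * f x) =
    (\<lambda>x. complex_of_real (x $ k) * (D_op j ^^ Suc n) f x
      + of_nat (Suc n) * (if j = k then - \<i> else 0) * (D_op j ^^ n) f x)"
    (is "_ = (\<lambda>x. _ + _ * ?c * _)")
proof (induction n)
  case 0
  show ?case by (simp only: funpow.simps o_apply id_apply D_op_coord_mult[OF assms]) simp
next
  case (Suc n)
  have cl: "(D_op j ^^ m) f \<in> exp_polys S" for m using D_op_funpow_closed[OF assms] .
  have "(D_op j ^^ Suc (Suc n)) (\<lambda>x. complex_of_real (x $ k) * f x) =
      D_op j (\<lambda>x. complex_of_real (x $ k) * (D_op j ^^ Suc n) f x
        + of_nat (Suc n) * ?c * (D_op j ^^ n) f x)"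
    using Suc by simp
  also have "\<dots> = (\<lambda>x. (complex_of_real (x $ k) * D_op j ((D_op j ^^ Suc n) f) x + ?c * (D_op j ^^ Suc n) f x)
      + of_nat (Suc n) * ?c * D_op j ((D_op j ^^ n) f) x)"
    unfolding D_op_exp_polys_add[OF exp_polys.coord[OF cl] exp_polys.scale[OF cl]]
      D_op_coord_mult[OF cl] D_op_exp_polys_scale[OF cl] ..
  also have "\<dots> = (\<lambda>x. complex_of_real (x $ k) * (D_op j ^^ Suc (Suc n)) f x
      + of_nat (Suc (Suc n)) * ?c * (D_op j ^^ Suc n) f x)"
    by (simp add: algebra_simps)
  finally show ?case .
qed

text \<open>If \<open>a $ j = 0\<close>, the character does not depend on \<open>x $ j\<close> and
  is integrated by repeated multiplication with \<open>x $ j\<close>, up to constants. Otherwise it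
  is an eigenfunction of \<open>D_op j\<close> with nonzero eigenvalue, by whose power one
  divides.\<close>

lemma iterated_antiderivative_character:
  assumes "character a \<in> exp_polys S"
  shows "\<exists>F\<in>exp_polys S. (D_op j ^^ n) F = character a"
proof (cases "a $ j = 0")
  case True
  \<comment> \<open>The second conjunct removes the term \<open>x $ j\<close> times
    \<open>(D_op j ^^ Suc n) F\<close> when the next antiderivative is differentiated.\<close>
  have "\<exists>F\<in>exp_polys S. (D_op j ^^ n) F = character a \<and> (D_op j ^^ Suc n) F = (\<lambda>x. 0)"
  proof (induction n)
    case 0
    show ?case using assms True by (intro bexI[of _ "character a"]) (auto simp: D_op_character)
  next
    case (Suc n)
    then obtain F where F: "F \<in> exp_polys S" "(D_op j ^^ n) F = character a" "(D_op j ^^ Suc n) F = (\<lambda>x. 0)"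
      by blast
    \<comment> \<open>Differentiating the product with \<open>x $ j\<close> produces the factor
      \<open>- \<i>\<close> times \<open>Suc n\<close>, which the constant in front cancels.\<close>
    define G where "G x = \<i> / of_nat (Suc n) * (complex_of_real (x $ j) * F x)" for x
    have G: "G \<in> exp_polys S" unfolding G_def by (intro exp_polys.scale exp_polys.coord F)
    have "(D_op j ^^ Suc n) G = character a"
      unfolding G_def D_op_funpow_scale[OF exp_polys.coord[OF F(1)]] D_op_funpow_coord_mult[OF F(1)] F(2,3)
      by (simp del: of_nat_Suc)
    then show ?case
      using G True by (intro bexI[of _ G]) (simp_all add: D_op_character)
  qed
  then show ?thesis by blast
next
  case False
  have "(D_op j ^^ n) (\<lambda>x. (1 / complex_of_real (a $ j)) ^ n * character a x) = character a"
  proof -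
    have "(D_op j ^^ n) (character a) = (\<lambda>x. complex_of_real (a $ j) ^ n * character a x)"
    proof (induction n)
      case (Suc n)
      have "(D_op j ^^ Suc n) (character a) = D_op j (\<lambda>x. complex_of_real (a $ j) ^ n * character a x)"
        using Suc by simp
      then show ?case unfolding D_op_exp_polys_scale[OF assms] D_op_character by (simp add: mult_ac)
    qed simp
    then show ?thesis
      unfolding D_op_funpow_scale[OF assms] using False by (simp add: power_one_over)
  qed
  then show ?thesis using exp_polys.scale[OF assms] by blast
qed

text \<open>An antiderivative of \<open>x\<^sub>j f\<close> is built from a second antiderivative of \<open>f\<close>, so the induction
  only goes through for all orders \<open>n\<close> simultaneously.\<close>

lemma iterated_antiderivative:
  assumes "g \<in> exp_polys S"
  shows "\<exists>F\<in>exp_polys S. (D_op j ^^ n) F = g"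
  using assms
proof (induction arbitrary: n rule: exp_polys.induct)
  case (character a)
  then show ?case by (intro iterated_antiderivative_character exp_polys.character)
next
  case (coord f k)
  show ?case
  proof (cases n)
    case 0
    then show ?thesis using exp_polys.coord[OF coord.hyps] by auto
  next
    case (Suc m)
    obtain F where F: "F \<in> exp_polys S" "(D_op j ^^ Suc (Suc m)) F = f"
      using coord.IH by blast
    \<comment> \<open>Applying \<open>D_op j ^^ Suc m\<close> to \<open>x $ k\<close> times
      \<open>D_op j F\<close> gives \<open>x $ k\<close> times \<open>f\<close> plus
      \<open>c\<close> times \<open>(D_op j ^^ Suc m) F\<close>; subtracting \<open>c * F x\<close>
      in \<open>G\<close> removes the surplus.\<close>
    define c where "c = of_nat (Suc m) * (if j = k then - \<i> else 0)"
    define G where "G x = complex_of_real (x $ k) * D_op j F x - c * F x" for x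
    have cl: "(\<lambda>x. complex_of_real (x $ k) * D_op j F x) \<in> exp_polys S"
      by (intro exp_polys.coord D_op_closed F)
    have "(D_op j ^^ Suc m) G =
        (\<lambda>x. (D_op j ^^ Suc m) (\<lambda>x. complex_of_real (x $ k) * D_op j F x) x
          + (- c) * (D_op j ^^ Suc m) F x)"
      using D_op_funpow_add[OF cl exp_polys.scale[OF F(1), of "- c"], of "Suc m" j]
      unfolding D_op_funpow_scale[OF F(1)] G_def by simp
    also have "\<dots> = (\<lambda>x. complex_of_real (x $ k) * f x)"
      unfolding D_op_funpow_coord_mult[OF D_op_closed[OF F(1)]] F(2)[symmetric] c_def
      by (simp add: funpow_swap1)
    finally show ?thesis
      using Suc exp_polys_diff[OF cl exp_polys.scale[OF F(1)]] unfolding G_def by blast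
  qed
next
  case (add f g)
  then obtain F G where "F \<in> exp_polys S" "(D_op j ^^ n) F = f" "G \<in> exp_polys S" "(D_op j ^^ n) G = g"
    by meson
  then show ?case
    by (intro bexI[of _ "\<lambda>x. F x + G x"] exp_polys.add) (simp_all add: D_op_funpow_add)
next
  case (scale f c)
  then obtain F where "F \<in> exp_polys S" "(D_op j ^^ n) F = f"
    by meson
  then show ?case
    by (intro bexI[of _ "\<lambda>x. c * F x"] exp_polys.scale) (simp_all add: D_op_funpow_scale)
qed

text \<open>Normalising antiderivatives to vanish on \<open>x\<^sub>j = 0\<close> makes integration in \<open>x\<^sub>j\<close> commute with the
  other partial derivatives.\<close>

lemma hyperplane_restriction_closed:
  "f \<in> exp_polys S \<Longrightarrow> (\<lambda>x. f (x - x $ j *\<^sub>R axis j 1)) \<in> exp_polys S"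
proof (induction rule: exp_polys.induct)
  case (character a)
  \<comment> \<open>Setting \<open>x $ j\<close> to 0 in a character amounts to replacing the
    frequency \<open>a $ j\<close> by 0, which lies in \<open>S\<close>.\<close>
  have "character (a - a $ j *\<^sub>R axis j 1) \<in> exp_polys S"
    using character zero by (intro exp_polys.character) (simp add: axis_def)
  moreover have "character (a - a $ j *\<^sub>R axis j 1) = (\<lambda>x. character a (x - x $ j *\<^sub>R axis j 1))"
    by (simp add: character_def fun_eq_iff inner_diff_left inner_diff_right inner_axis inner_axis' mult.commute)
  ultimately show ?case by simp
next
  case (coord f k)
  show ?case
  proof (cases "k = j")
    case True
    then show ?thesis using exp_polys_const[OF zero, of 0] by (simp add: axis_def)
  next
    case False
    then show ?thesis using exp_polys.coord[OF coord.IH, of k] by (simp add: axis_def)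
  qed
qed (auto intro: exp_polys.add exp_polys.scale)

text \<open>The clause on the other directions ensures, in \<open>poincare\<close>, that solving a
  further equation does not disturb those already solved. \<open>F\<close> is a primitive
  \<open>H\<close> minus its restriction \<open>R\<close> to the hyperplane, extended constantly
  along the \<open>j\<close>-th axis.\<close>

lemma antiderivative:
  assumes g: "g \<in> exp_polys S"
  shows "\<exists>F\<in>exp_polys S. D_op j F = g \<and> (\<forall>i. i \<noteq> j \<and> D_op i g = (\<lambda>x. 0) \<longrightarrow> D_op i F = (\<lambda>x. 0))"
proof -
  obtain H where H: "H \<in> exp_polys S" "D_op j H = g"
    using iterated_antiderivative[OF g, where n=1 and j=j] by auto
  define R where "R x = H (x - x $ j *\<^sub>R axis j 1)" for x
  define F where "F x = H x - R x" for x
  have R: "R \<in> exp_polys S" unfolding R_def by (rule hyperplane_restriction_closed[OF H(1)])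
  have F: "F \<in> exp_polys S" unfolding F_def by (rule exp_polys_diff[OF H(1) R])
  have "R (x + t *\<^sub>R axis j 1) = R x" for x t
    by (simp add: R_def axis_def algebra_simps)
  then have "D_op j R = (\<lambda>x. 0)" by (intro D_opI) simp
  then have DF: "D_op j F = g" unfolding F_def D_op_diff[OF H(1) R] H(2) by simp
  have F0: "F x = 0" if "x $ j = 0" for x using that by (simp add: F_def R_def)
  \<comment> \<open>\<open>D_op i F\<close> is killed by \<open>D_op j\<close>, as
    \<open>D_op i g\<close> vanishes, and it is zero on the hyperplane because \<open>F\<close> is
    and \<open>axis i 1\<close> is parallel to it.\<close>
  have "D_op i F = (\<lambda>x. 0)" if "i \<noteq> j" "D_op i g = (\<lambda>x. 0)" for i
  proof (rule vanishing_on_hyperplane_imp_zero[where j=j])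
    show "D_op i F differentiable (at x)" for x
      by (rule exp_polys_differentiable[OF D_op_closed[OF F]])
    show "D_op j (D_op i F) = (\<lambda>x. 0)"
      using D_op_commute[OF F, of j i] that DF by simp
    show "D_op i F x = 0" if "x $ j = 0" for x
    proof -
      have "F (x + t *\<^sub>R axis i 1) = 0" for t
        using that \<open>i \<noteq> j\<close> by (intro F0) (simp add: axis_def)
      then show ?thesis by (simp add: D_op_def)
    qed
  qed
  then show ?thesis using F DF by blast
qed

text \<open>Induction on the set of equations. If \<open>f\<close> solves those in \<open>J\<close>,
  compatibility makes the defect \<open>h\<close> of the new equation annihilated by every
  \<open>D_op j\<close> with \<open>j\<close> in \<open>J\<close>. A normalised primitive
  \<open>F\<close> of \<open>h\<close> inherits this, so \<open>f\<close> plus \<open>F\<close>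
  solves all of them.\<close>

lemma poincare:
  assumes "finite J" "\<And>j. j \<in> J \<Longrightarrow> g j \<in> exp_polys S"
    "\<And>i j. i \<in> J \<Longrightarrow> j \<in> J \<Longrightarrow> D_op i (g j) = D_op j (g i)"
  shows "\<exists>f\<in>exp_polys S. \<forall>j\<in>J. D_op j f = g j"
  using assms
proof (induction J rule: finite_induct)
  case empty
  show ?case using exp_polys_const[OF zero] by blast
next
  case (insert k J)
  then obtain f where f: "f \<in> exp_polys S" "\<And>j. j \<in> J \<Longrightarrow> D_op j f = g j"
    by (metis insertCI)
  define h where "h x = g k x - D_op k f x" for x
  have h: "h \<in> exp_polys S"
    unfolding h_def using insert.prems f by (intro exp_polys_diff D_op_closed) auto
  have Dh: "D_op j h = (\<lambda>x. 0)" if "j \<in> J" for j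
  proof -
    have "D_op j h = (\<lambda>x. D_op j (g k) x - D_op j (D_op k f) x)"
      unfolding h_def using insert.prems f by (intro D_op_diff D_op_closed) auto
    also have "D_op j (D_op k f) = D_op j (g k)"
      using D_op_commute[OF f(1), of j k] f(2)[OF that] insert.prems(2)[of k j] that by simp
    finally show ?thesis by simp
  qed
  obtain F where F: "F \<in> exp_polys S" "D_op k F = h"
      "\<And>i. i \<noteq> k \<Longrightarrow> D_op i h = (\<lambda>x. 0) \<Longrightarrow> D_op i F = (\<lambda>x. 0)"
    using antiderivative[OF h, of k] by blast
  have "D_op j (\<lambda>x. f x + F x) = g j" if "j \<in> insert k J" for j
  proof (cases "j = k")
    case True
    then show ?thesis by (simp add: D_op_exp_polys_add[OF f(1) F(1)] F(2) h_def fun_eq_iff)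
  next
    case False
    then show ?thesis using that f(2) F(3) Dh by (simp add: D_op_exp_polys_add[OF f(1) F(1)])
  qed
  then show ?case using exp_polys.add[OF f(1) F(1)] by blast
qed

text \<open>Conjugation by the character turns \<open>D_op j\<close> minus \<open>a $ j\<close> into
  \<open>D_op j\<close> and the compatibility condition into that of \<open>poincare\<close>; the
  solution is then multiplied back.\<close>

lemma shifted_poincare:
  assumes a: "\<And>j. a $ j \<in> S" and g: "\<And>j. g j \<in> exp_polys S"
    and closed: "\<And>i j. D_act (Dlin i (a $ i)) (g j) = D_act (Dlin j (a $ j)) (g i)"
  shows "\<exists>f\<in>exp_polys S. \<forall>j. D_act (Dlin j (a $ j)) f = g j"
proof -
  define h where "h j x = character (- a) x * g j x" for j x
  have h: "h j \<in> exp_polys S" for j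
    unfolding h_def using a minus by (intro character_mult_closed g) auto
  have "D_op i (h j) = D_op j (h i)" for i j
    unfolding h_def D_op_character_mult[OF g]
    using closed[of i j] by (simp add: D_act_Dlin[OF g] fun_eq_iff)
  then obtain f where f: "f \<in> exp_polys S" "\<And>j. D_op j f = h j"
    using poincare[of UNIV h] h by auto
  have cl: "(\<lambda>x. character a x * f x) \<in> exp_polys S" by (intro character_mult_closed a f)
  have "D_act (Dlin j (a $ j)) (\<lambda>x. character a x * f x) = g j" for j
    unfolding D_act_Dlin[OF cl] D_op_character_mult[OF f(1)] f(2) h_def
    by (simp add: distrib_left mult.left_commute) (simp add: character_minus flip: mult.assoc)
  then show ?thesis using cl by blast
qed

end

section \<open>Extension of partial homomorphisms\<close>

text \<open>The \<open>U k\<close> are the ascending chain of quotient ideals of \<open>I\<close> by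
  \<open>d ^ k\<close>. Their union is finitely generated, its generators lie in a single
  \<open>U k\<close>, and the chain is stationary from there on.\<close>

lemma ideal_quotient_stable:
  fixes I :: "'n::finite diff_op set"
  assumes I: "is_ideal I"
  shows "\<exists>k. \<forall>P l. P * d ^ l \<in> I \<longrightarrow> P * d ^ k \<in> I"
proof -
  define U where "U k = {P. P * d ^ k \<in> I}" for k :: nat
  have ideal: "is_ideal (U k)" for k
    using I unfolding is_ideal_def U_def by (auto simp: distrib_right mult.assoc)
  have mono: "U k \<subseteq> U l" if "k \<le> l" for k l
  proof
    fix P assume "P \<in> U k"
    then have "d ^ (l - k) * (P * d ^ k) \<in> I" using I by (simp add: U_def is_ideal_def)
    also have "d ^ (l - k) * (P * d ^ k) = P * d ^ l"
      using that by (simp add: mult.left_commute flip: power_add)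
    finally show "P \<in> U l" by (simp add: U_def)
  qed
  have "is_ideal (\<Union>k. U k)"
    unfolding is_ideal_def
  proof (intro conjI ballI allI)
    show "0 \<in> (\<Union>k. U k)" using ideal[of 0] by (auto simp: is_ideal_def)
    fix x assume "x \<in> (\<Union>k. U k)"
    then obtain k where k: "x \<in> U k" by blast
    then have "r * x \<in> U k" for r using ideal[of k] by (simp add: is_ideal_def)
    then show "r * x \<in> (\<Union>k. U k)" for r by blast
    fix y assume "y \<in> (\<Union>k. U k)"
    then obtain l where "y \<in> U l" by blast
    with k have "x \<in> U (max k l)" "y \<in> U (max k l)"
      using mono[of k "max k l"] mono[of l "max k l"] by auto
    then have "x + y \<in> U (max k l)" using ideal[of "max k l"] by (auto simp: is_ideal_def)
    then show "x + y \<in> (\<Union>k. U k)" by blast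
  qed
  from hilbert_basis[OF this] obtain G where G: "G \<subseteq> (\<Union>k. U k)" "finite G"
      "\<forall>J. is_ideal J \<longrightarrow> G \<subseteq> J \<longrightarrow> (\<Union>k. U k) \<subseteq> J" .
  have "\<exists>k. G \<subseteq> U k"
    using G(2,1)
  proof (induction G rule: finite_induct)
    case (insert P G)
    then obtain k l where "P \<in> U k" "G \<subseteq> U l" by blast
    then have "insert P G \<subseteq> U (max k l)"
      using mono[of k "max k l"] mono[of l "max k l"] by auto
    then show ?case by blast
  qed auto
  then obtain k where "G \<subseteq> U k" by blast
  then have "(\<Union>k. U k) \<subseteq> U k" using G(3) ideal by simp
  then show ?thesis unfolding U_def by (intro exI[of _ k]) blast
qed

lemma Dlin_prod_power: "\<exists>ss. set ss \<subseteq> set rs \<and> Dlin_prod j rs ^ k = Dlin_prod j ss"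
proof (induction k)
  case 0
  show ?case by (intro exI[of _ "[]"]) simp
next
  case (Suc k)
  then obtain ss where "set ss \<subseteq> set rs" "Dlin_prod j rs ^ k = Dlin_prod j ss" by blast
  then show ?case by (intro exI[of _ "rs @ ss"]) simp
qed

section \<open>Modules over the operator ring and eigenvectors modulo a stable subset\<close>

locale diff_op_module = Module.module "diff_op_ring :: 'n::finite diff_op ring" M
  for M :: "('n::finite diff_op, 'm, 'x) module_scheme" (structure)
begin

lemma act_closed [simp, intro]: "x \<in> carrier M \<Longrightarrow> P \<odot> x \<in> carrier M"
  using smult_closed[of P x] by (simp add: diff_op_ring_def)

lemma act_add_left: "x \<in> carrier M \<Longrightarrow> (P + Q) \<odot> x = P \<odot> x \<oplus> Q \<odot> x"
  using smult_l_distr[of P Q x] by (simp add: diff_op_ring_def)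

lemma act_add_right: "x \<in> carrier M \<Longrightarrow> y \<in> carrier M \<Longrightarrow> P \<odot> (x \<oplus> y) = P \<odot> x \<oplus> P \<odot> y"
  using smult_r_distr[of P x y] by (simp add: diff_op_ring_def)

lemma act_mult: "x \<in> carrier M \<Longrightarrow> (P * Q) \<odot> x = P \<odot> (Q \<odot> x)"
  using smult_assoc1[of P Q x] by (simp add: diff_op_ring_def)

lemma act_one [simp]: "x \<in> carrier M \<Longrightarrow> 1 \<odot> x = x"
  using smult_one[of x] by (simp add: diff_op_ring_def)

lemma act_zero_left [simp]: "x \<in> carrier M \<Longrightarrow> 0 \<odot> x = \<zero>"
  using smult_l_null[of x] by (simp add: diff_op_ring_def)

lemma act_zero_right [simp]: "P \<odot> \<zero> = \<zero>"
  using smult_r_null[of P] by (simp add: diff_op_ring_def)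

lemma act_commute: "x \<in> carrier M \<Longrightarrow> P \<odot> (Q \<odot> x) = Q \<odot> (P \<odot> x)"
  by (metis act_mult mult.commute)

lemma act_uminus: "x \<in> carrier M \<Longrightarrow> (- P) \<odot> x = \<ominus> (P \<odot> x)"
  using act_add_left[of x "- P" P] by (simp add: M.minus_equality)

text \<open>Apply the factors one after another, beginning at the end of the list. As
  \<open>z\<close> lies outside \<open>L\<close> and the full product sends it into
  \<open>L\<close>, some step enters \<open>L\<close>; \<open>Q\<close> is the partial product
  before that step.\<close>

lemma ex_eigenvector_mod:
  assumes "z \<in> carrier M" "z \<notin> L" "Dlin_prod k rs \<odot> z \<in> L"
  shows "\<exists>Q. \<exists>r\<in>set rs. Q \<odot> z \<notin> L \<and> Dlin k r \<odot> (Q \<odot> z) \<in> L"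
  using assms(3)
proof (induction rs)
  case Nil
  then show ?case using assms by simp
next
  case (Cons r rs)
  then show ?case
    using assms(1) by (cases "Dlin_prod k rs \<odot> z \<in> L") (auto simp: act_mult)
qed

text \<open>One coordinate at a time: a further operator \<open>Q\<close> achieves the new relation,
  and the earlier ones survive because operators commute and \<open>L\<close> is stable. This is
  applied to the domain of a partial homomorphism and to the zero submodule.\<close>

lemma ex_joint_eigenvector_mod:
  assumes y: "y \<in> carrier M" "y \<notin> L"
    and L: "\<And>P x. x \<in> L \<Longrightarrow> P \<odot> x \<in> L"
    and tors: "\<And>j. \<exists>rs. set rs \<subseteq> S \<and> Dlin_prod j rs \<odot> y \<in> L"
  shows "\<exists>P a. P \<odot> y \<notin> L \<and> (\<forall>j. a $ j \<in> S \<and> Dlin j (a $ j) \<odot> (P \<odot> y) \<in> L)"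
proof -
  have "\<exists>P a. P \<odot> y \<notin> L \<and> (\<forall>j\<in>J. a j \<in> S \<and> Dlin j (a j) \<odot> (P \<odot> y) \<in> L)" if "finite J" for J
    using that
  proof (induction J rule: finite_induct)
    case empty
    show ?case using y by (intro exI[of _ 1]) auto
  next
    case (insert k J)
    then obtain P a where P: "P \<odot> y \<notin> L" "\<And>j. j \<in> J \<Longrightarrow> a j \<in> S \<and> Dlin j (a j) \<odot> (P \<odot> y) \<in> L"
      by blast
    obtain rs where rs: "set rs \<subseteq> S" "Dlin_prod k rs \<odot> y \<in> L" using tors by blast
    then have "Dlin_prod k rs \<odot> (P \<odot> y) \<in> L" using L act_commute[OF y(1)] by metis
    then obtain Q r where Q: "r \<in> set rs" "Q \<odot> (P \<odot> y) \<notin> L" "Dlin k r \<odot> (Q \<odot> (P \<odot> y)) \<in> L"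
      using ex_eigenvector_mod[of "P \<odot> y" L k rs] P(1) y(1) by blast
    have J: "Dlin j (a j) \<odot> (Q \<odot> (P \<odot> y)) \<in> L" if "j \<in> J" for j
      using P(2)[OF that] L act_commute[of "P \<odot> y" "Dlin j (a j)" Q] y(1) by simp
    show ?case
      using Q rs J P(2) insert.hyps y(1)
      by (intro exI[of _ "Q * P"] exI[of _ "a(k := r)"]) (auto simp: act_mult)
  qed
  from this[of UNIV] obtain P a where
    "P \<odot> y \<notin> L" "\<And>j. a j \<in> S \<and> Dlin j (a j) \<odot> (P \<odot> y) \<in> L" by auto
  then show ?thesis by (intro exI[of _ P] exI[of _ "\<chi> j. a j"]) auto
qed

end

section \<open>Partial homomorphisms and their extensions\<close>

locale diff_op_modules = N: diff_op_module N + E: diff_op_module E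
  for N :: "('n::finite diff_op, 'c, 'x) module_scheme"
    and E :: "('n::finite diff_op, 'e, 'y) module_scheme"
begin

text \<open>Homomorphisms from submodules of \<open>N\<close> to \<open>E\<close>, encoded by their graphs.\<close>

definition partial_hom :: "('c \<times> 'e) set \<Rightarrow> bool" where
  "partial_hom G \<longleftrightarrow> G \<subseteq> carrier N \<times> carrier E \<and> (\<zero>\<^bsub>N\<^esub>, \<zero>\<^bsub>E\<^esub>) \<in> G \<and>
    (\<forall>u f v g. (u, f) \<in> G \<and> (v, g) \<in> G \<longrightarrow> (u \<oplus>\<^bsub>N\<^esub> v, f \<oplus>\<^bsub>E\<^esub> g) \<in> G) \<and>
    (\<forall>P u f. (u, f) \<in> G \<longrightarrow> (P \<odot>\<^bsub>N\<^esub> u, P \<odot>\<^bsub>E\<^esub> f) \<in> G) \<and>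
    (\<forall>f. (\<zero>\<^bsub>N\<^esub>, f) \<in> G \<longrightarrow> f = \<zero>\<^bsub>E\<^esub>)"

lemma partial_homD:
  assumes "partial_hom G"
  shows "(u, f) \<in> G \<Longrightarrow> u \<in> carrier N" "(u, f) \<in> G \<Longrightarrow> f \<in> carrier E"
    "(\<zero>\<^bsub>N\<^esub>, \<zero>\<^bsub>E\<^esub>) \<in> G"
    "(u, f) \<in> G \<Longrightarrow> (v, g) \<in> G \<Longrightarrow> (u \<oplus>\<^bsub>N\<^esub> v, f \<oplus>\<^bsub>E\<^esub> g) \<in> G"
    "(u, f) \<in> G \<Longrightarrow> (P \<odot>\<^bsub>N\<^esub> u, P \<odot>\<^bsub>E\<^esub> f) \<in> G"
    "(\<zero>\<^bsub>N\<^esub>, f) \<in> G \<Longrightarrow> f = \<zero>\<^bsub>E\<^esub>"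
proof -
  have sub: "G \<subseteq> carrier N \<times> carrier E"
    and 0: "(\<zero>\<^bsub>N\<^esub>, \<zero>\<^bsub>E\<^esub>) \<in> G"
    and plus: "\<forall>u f v g. (u, f) \<in> G \<and> (v, g) \<in> G \<longrightarrow> (u \<oplus>\<^bsub>N\<^esub> v, f \<oplus>\<^bsub>E\<^esub> g) \<in> G"
    and act: "\<forall>P u f. (u, f) \<in> G \<longrightarrow> (P \<odot>\<^bsub>N\<^esub> u, P \<odot>\<^bsub>E\<^esub> f) \<in> G"
    and fun0: "\<forall>f. (\<zero>\<^bsub>N\<^esub>, f) \<in> G \<longrightarrow> f = \<zero>\<^bsub>E\<^esub>"
    using assms unfolding partial_hom_def by - (elim conjE, assumption)+
  show "(u, f) \<in> G \<Longrightarrow> u \<in> carrier N" "(u, f) \<in> G \<Longrightarrow> f \<in> carrier E"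
    using sub by auto
  show "(\<zero>\<^bsub>N\<^esub>, \<zero>\<^bsub>E\<^esub>) \<in> G" by (rule 0)
  show "(u, f) \<in> G \<Longrightarrow> (v, g) \<in> G \<Longrightarrow> (u \<oplus>\<^bsub>N\<^esub> v, f \<oplus>\<^bsub>E\<^esub> g) \<in> G" using plus by simp
  show "(u, f) \<in> G \<Longrightarrow> (P \<odot>\<^bsub>N\<^esub> u, P \<odot>\<^bsub>E\<^esub> f) \<in> G" using act by simp
  show "(\<zero>\<^bsub>N\<^esub>, f) \<in> G \<Longrightarrow> f = \<zero>\<^bsub>E\<^esub>" using fun0 by simp
qed

text \<open>Two values at \<open>u\<close> differ by a value at zero. The negative is taken as the
  action of \<open>- 1\<close>, under which \<open>G\<close> is closed.\<close>

lemma partial_hom_unique: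
  assumes G: "partial_hom G" and f: "(u, f) \<in> G" and g: "(u, g) \<in> G"
  shows "f = g"
proof -
  note c = partial_homD(1,2)[OF G f] partial_homD(2)[OF G g]
  have "(u \<oplus>\<^bsub>N\<^esub> (- 1) \<odot>\<^bsub>N\<^esub> u, f \<oplus>\<^bsub>E\<^esub> (- 1) \<odot>\<^bsub>E\<^esub> g) \<in> G"
    by (intro partial_homD(4,5)[OF G] f g)
  then have "f \<oplus>\<^bsub>E\<^esub> \<ominus>\<^bsub>E\<^esub> g = \<zero>\<^bsub>E\<^esub>"
    using c partial_homD(6)[OF G] by (simp add: N.act_uminus E.act_uminus N.M.r_neg)
  then show ?thesis using c by (metis E.M.minus_minus E.M.minus_equality E.M.a_inv_closed)
qed

text \<open>The new domain consists of the sums of some \<open>u\<close> and some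
  \<open>P y\<close>, with value \<open>f\<close> plus \<open>P f0\<close>. Assumption
  \<open>ext\<close> says that this agrees with \<open>G\<close> on the multiples of
  \<open>y\<close> already in the domain, which makes it well defined.\<close>

lemma partial_hom_extend:
  assumes G: "partial_hom G" and y: "y \<in> carrier N" and f0: "f0 \<in> carrier E"
    and ext: "\<And>P f. (P \<odot>\<^bsub>N\<^esub> y, f) \<in> G \<Longrightarrow> f = P \<odot>\<^bsub>E\<^esub> f0"
  shows "\<exists>G'. partial_hom G' \<and> G \<subseteq> G' \<and> (y, f0) \<in> G'"
proof -
  define G' where "G' = {(u \<oplus>\<^bsub>N\<^esub> P \<odot>\<^bsub>N\<^esub> y, f \<oplus>\<^bsub>E\<^esub> P \<odot>\<^bsub>E\<^esub> f0) | u f P. (u, f) \<in> G}"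
  have I: "(u \<oplus>\<^bsub>N\<^esub> P \<odot>\<^bsub>N\<^esub> y, f \<oplus>\<^bsub>E\<^esub> P \<odot>\<^bsub>E\<^esub> f0) \<in> G'" if "(u, f) \<in> G" for u f P
    unfolding G'_def using that by blast
  note c [simp] = partial_homD(1,2)[OF G]
  have sub: "G \<subseteq> G'"
  proof
    fix p assume "p \<in> G"
    then show "p \<in> G'" using I[of "fst p" "snd p" 0] y f0 c[of "fst p" "snd p"] by simp
  qed
  have "(\<zero>\<^bsub>N\<^esub> \<oplus>\<^bsub>N\<^esub> 1 \<odot>\<^bsub>N\<^esub> y, \<zero>\<^bsub>E\<^esub> \<oplus>\<^bsub>E\<^esub> 1 \<odot>\<^bsub>E\<^esub> f0) \<in> G'"
    by (rule I[OF partial_homD(3)[OF G]])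
  then have "(y, f0) \<in> G'" using y f0 by simp
  moreover have "partial_hom G'"
    unfolding partial_hom_def
  proof (intro conjI allI impI)
    show "G' \<subseteq> carrier N \<times> carrier E"
      unfolding G'_def using y f0 by auto
    show "(\<zero>\<^bsub>N\<^esub>, \<zero>\<^bsub>E\<^esub>) \<in> G'" using sub partial_homD(3)[OF G] by blast
  next
    fix u f v g assume "(u, f) \<in> G' \<and> (v, g) \<in> G'"
    then obtain u' f' P v' g' Q where *: "(u', f') \<in> G" "(v', g') \<in> G"
      "u = u' \<oplus>\<^bsub>N\<^esub> P \<odot>\<^bsub>N\<^esub> y" "f = f' \<oplus>\<^bsub>E\<^esub> P \<odot>\<^bsub>E\<^esub> f0"
      "v = v' \<oplus>\<^bsub>N\<^esub> Q \<odot>\<^bsub>N\<^esub> y" "g = g' \<oplus>\<^bsub>E\<^esub> Q \<odot>\<^bsub>E\<^esub> f0"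
      unfolding G'_def by blast
    have "u \<oplus>\<^bsub>N\<^esub> v = (u' \<oplus>\<^bsub>N\<^esub> v') \<oplus>\<^bsub>N\<^esub> (P + Q) \<odot>\<^bsub>N\<^esub> y"
      using * y c[OF *(1)] c[OF *(2)] by (simp add: N.act_add_left N.M.a_ac)
    moreover have "f \<oplus>\<^bsub>E\<^esub> g = (f' \<oplus>\<^bsub>E\<^esub> g') \<oplus>\<^bsub>E\<^esub> (P + Q) \<odot>\<^bsub>E\<^esub> f0"
      using * f0 c[OF *(1)] c[OF *(2)] by (simp add: E.act_add_left E.M.a_ac)
    ultimately show "(u \<oplus>\<^bsub>N\<^esub> v, f \<oplus>\<^bsub>E\<^esub> g) \<in> G'"
      using I[OF partial_homD(4)[OF G *(1,2)], of "P + Q"] by simp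
  next
    fix Q u f assume "(u, f) \<in> G'"
    then obtain u' f' P where *: "(u', f') \<in> G"
      "u = u' \<oplus>\<^bsub>N\<^esub> P \<odot>\<^bsub>N\<^esub> y" "f = f' \<oplus>\<^bsub>E\<^esub> P \<odot>\<^bsub>E\<^esub> f0"
      unfolding G'_def by blast
    have "Q \<odot>\<^bsub>N\<^esub> u = Q \<odot>\<^bsub>N\<^esub> u' \<oplus>\<^bsub>N\<^esub> (Q * P) \<odot>\<^bsub>N\<^esub> y"
      using * y c[OF *(1)] by (simp add: N.act_add_right N.act_mult)
    moreover have "Q \<odot>\<^bsub>E\<^esub> f = Q \<odot>\<^bsub>E\<^esub> f' \<oplus>\<^bsub>E\<^esub> (Q * P) \<odot>\<^bsub>E\<^esub> f0"
      using * f0 c[OF *(1)] by (simp add: E.act_add_right E.act_mult)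
    ultimately show "(Q \<odot>\<^bsub>N\<^esub> u, Q \<odot>\<^bsub>E\<^esub> f) \<in> G'"
      using I[OF partial_homD(5)[OF G *(1)], of Q "Q * P"] by simp
  next
    fix f assume "(\<zero>\<^bsub>N\<^esub>, f) \<in> G'"
    then obtain u f' P where *: "(u, f') \<in> G"
      "\<zero>\<^bsub>N\<^esub> = u \<oplus>\<^bsub>N\<^esub> P \<odot>\<^bsub>N\<^esub> y" "f = f' \<oplus>\<^bsub>E\<^esub> P \<odot>\<^bsub>E\<^esub> f0"
      unfolding G'_def by blast
    \<comment> \<open>A representation of zero exhibits a multiple of \<open>y\<close> in the old
      domain, where \<open>ext\<close> fixes the value.\<close>
    have "u = (- P) \<odot>\<^bsub>N\<^esub> y"
      using *(2) y c[OF *(1)] by (simp add: N.act_uminus N.M.minus_equality)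
    then have "f' = (- P) \<odot>\<^bsub>E\<^esub> f0" using ext *(1) by blast
    then show "f = \<zero>\<^bsub>E\<^esub>" using *(3) f0 by (simp add: E.act_uminus E.M.l_neg)
  qed
  ultimately show ?thesis using sub by blast
qed

text \<open>Zorn's lemma for inclusion of graphs. Any two pairs in the union of a chain lie in a
  common member, so the defining conditions pass to the union.\<close>

lemma ex_maximal_partial_hom:
  assumes G0: "partial_hom G0"
  shows "\<exists>G. partial_hom G \<and> G0 \<subseteq> G \<and> (\<forall>G'. partial_hom G' \<longrightarrow> G \<subseteq> G' \<longrightarrow> G' = G)"
proof -
  let ?A = "{G. partial_hom G \<and> G0 \<subseteq> G}"
  have "\<exists>M\<in>?A. \<forall>X\<in>?A. M \<subseteq> X \<longrightarrow> X = M"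
  proof (rule subset_Zorn_nonempty)
    show "?A \<noteq> {}" using G0 by blast
    fix C assume C: "C \<noteq> {}" "subset.chain ?A C"
    then have ph: "partial_hom G" "G0 \<subseteq> G" if "G \<in> C" for G
      using that by (auto simp: subset.chain_def)
    have dir: "\<exists>G\<in>C. p \<in> G \<and> q \<in> G" if "p \<in> \<Union>C" "q \<in> \<Union>C" for p q
      using that C(2) unfolding subset_chain_def by blast
    have "partial_hom (\<Union>C)"
      unfolding partial_hom_def
    proof (intro conjI allI impI)
      show "\<Union>C \<subseteq> carrier N \<times> carrier E" using ph(1) unfolding partial_hom_def by blast
      show "(\<zero>\<^bsub>N\<^esub>, \<zero>\<^bsub>E\<^esub>) \<in> \<Union>C" using C(1) partial_homD(3)[OF ph(1)] by blast
    next
      fix u f v g assume "(u, f) \<in> \<Union>C \<and> (v, g) \<in> \<Union>C"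
      then obtain G where "G \<in> C" "(u, f) \<in> G" "(v, g) \<in> G" using dir by blast
      then show "(u \<oplus>\<^bsub>N\<^esub> v, f \<oplus>\<^bsub>E\<^esub> g) \<in> \<Union>C" using partial_homD(4)[OF ph(1)] by blast
    next
      fix P u f assume "(u, f) \<in> \<Union>C"
      then show "(P \<odot>\<^bsub>N\<^esub> u, P \<odot>\<^bsub>E\<^esub> f) \<in> \<Union>C" using partial_homD(5)[OF ph(1)] by blast
    next
      fix f assume "(\<zero>\<^bsub>N\<^esub>, f) \<in> \<Union>C"
      then show "f = \<zero>\<^bsub>E\<^esub>" using partial_homD(6)[OF ph(1)] by blast
    qed
    then show "\<Union>C \<in> ?A" using C(1) ph(2) by blast
  qed
  then obtain G where G: "G \<in> ?A" "\<forall>X\<in>?A. G \<subseteq> X \<longrightarrow> X = G" ..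
  then have "partial_hom G" "G0 \<subseteq> G" by auto
  moreover have "G' = G" if "partial_hom G'" "G \<subseteq> G'" for G'
    using G(2) that \<open>G0 \<subseteq> G\<close> by simp
  ultimately show ?thesis by (intro exI[of _ G]) simp
qed

end

text \<open>These are the two properties through which exponential polynomials enter the extension
  argument: products of linear factors kill each element, and compatible first order systems are
  solvable.\<close>

locale torsion_divisible = diff_op_modules N E
  for N :: "('n::finite diff_op, 'c, 'x) module_scheme"
    and E :: "('n::finite diff_op, 'e, 'y) module_scheme" +
  fixes S :: "real set"
  assumes torsion: "f \<in> carrier E \<Longrightarrow> \<exists>rs. set rs \<subseteq> S \<and> Dlin_prod j rs \<odot>\<^bsub>E\<^esub> f = \<zero>\<^bsub>E\<^esub>"
    and solvable: "\<lbrakk>\<And>j. a $ j \<in> S; \<And>j. g j \<in> carrier E;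
      \<And>i j. Dlin i (a $ i) \<odot>\<^bsub>E\<^esub> g j = Dlin j (a $ j) \<odot>\<^bsub>E\<^esub> g i\<rbrakk> \<Longrightarrow>
      \<exists>f\<in>carrier E. \<forall>j. Dlin j (a $ j) \<odot>\<^bsub>E\<^esub> f = g j"
begin

section \<open>Maximal partial homomorphisms are total\<close>

lemma ideal_of_denominators:
  assumes G: "partial_hom G" and y: "y \<in> carrier N"
  shows "is_ideal {P. P \<odot>\<^bsub>N\<^esub> y \<in> Domain G}"
  unfolding is_ideal_def
proof (intro conjI ballI allI)
  show "0 \<in> {P. P \<odot>\<^bsub>N\<^esub> y \<in> Domain G}" using y partial_homD(3)[OF G] by auto
  fix P assume "P \<in> {P. P \<odot>\<^bsub>N\<^esub> y \<in> Domain G}"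
  then obtain f where f: "(P \<odot>\<^bsub>N\<^esub> y, f) \<in> G" by blast
  show "R * P \<in> {P. P \<odot>\<^bsub>N\<^esub> y \<in> Domain G}" for R
    using partial_homD(5)[OF G f, of R] y by (auto simp: N.act_mult)
  fix Q assume "Q \<in> {P. P \<odot>\<^bsub>N\<^esub> y \<in> Domain G}"
  then obtain g where g: "(Q \<odot>\<^bsub>N\<^esub> y, g) \<in> G" by blast
  show "P + Q \<in> {P. P \<odot>\<^bsub>N\<^esub> y \<in> Domain G}"
    using partial_homD(4)[OF G f g] y by (auto simp: N.act_add_left)
qed

text \<open>Finite generation of the ideal of all \<open>P\<close> with \<open>P y\<close> in the domain lets one product of linear
  factors serve for all values.\<close>

lemma values_uniformly_torsion:
  assumes G: "partial_hom G" and y: "y \<in> carrier N"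
  shows "\<exists>rs. set rs \<subseteq> S \<and> (\<forall>P f. (P \<odot>\<^bsub>N\<^esub> y, f) \<in> G \<longrightarrow> Dlin_prod j rs \<odot>\<^bsub>E\<^esub> f = \<zero>\<^bsub>E\<^esub>)"
proof -
  let ?I = "{P. P \<odot>\<^bsub>N\<^esub> y \<in> Domain G}"
  obtain B where B: "B \<subseteq> ?I" "finite B" "\<forall>J. is_ideal J \<longrightarrow> B \<subseteq> J \<longrightarrow> ?I \<subseteq> J"
    using hilbert_basis[OF ideal_of_denominators[OF G y]] .
  have "\<exists>rs. set rs \<subseteq> S \<and> (\<forall>P\<in>B. \<forall>f. (P \<odot>\<^bsub>N\<^esub> y, f) \<in> G \<longrightarrow> Dlin_prod j rs \<odot>\<^bsub>E\<^esub> f = \<zero>\<^bsub>E\<^esub>)"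
    using B(2,1)
  proof (induction B rule: finite_induct)
    case empty
    show ?case by (intro exI[of _ "[]"]) simp
  next
    case (insert P B)
    then obtain rs where rs: "set rs \<subseteq> S"
      "\<And>P f. P \<in> B \<Longrightarrow> (P \<odot>\<^bsub>N\<^esub> y, f) \<in> G \<Longrightarrow> Dlin_prod j rs \<odot>\<^bsub>E\<^esub> f = \<zero>\<^bsub>E\<^esub>" by blast
    obtain g where g: "(P \<odot>\<^bsub>N\<^esub> y, g) \<in> G" using insert.prems by blast
    then obtain ss where ss: "set ss \<subseteq> S" "Dlin_prod j ss \<odot>\<^bsub>E\<^esub> g = \<zero>\<^bsub>E\<^esub>"
      using torsion partial_homD(2)[OF G] by blast
    have "Dlin_prod j (rs @ ss) \<odot>\<^bsub>E\<^esub> f = \<zero>\<^bsub>E\<^esub>" if Q: "Q \<in> insert P B" "(Q \<odot>\<^bsub>N\<^esub> y, f) \<in> G" for Q f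
    proof (cases "Q = P")
      case True
      then have "f = g" using partial_hom_unique[OF G] Q g by blast
      then show ?thesis using ss partial_homD(2)[OF G g] by (simp add: E.act_mult)
    next
      case False
      then have "Dlin_prod j rs \<odot>\<^bsub>E\<^esub> f = \<zero>\<^bsub>E\<^esub>" using Q rs by blast
      then show ?thesis
        using partial_homD(2)[OF G Q(2)] by (subst Dlin_prod_simps, subst mult.commute) (simp add: E.act_mult)
    qed
    then show ?case using rs(1) ss(1) by (intro exI[of _ "rs @ ss"]) auto
  qed
  then obtain rs where rs: "set rs \<subseteq> S"
    "\<And>P f. P \<in> B \<Longrightarrow> (P \<odot>\<^bsub>N\<^esub> y, f) \<in> G \<Longrightarrow> Dlin_prod j rs \<odot>\<^bsub>E\<^esub> f = \<zero>\<^bsub>E\<^esub>" by blast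
  let ?d = "Dlin_prod j rs"
  \<comment> \<open>Since operators commute, the \<open>P\<close> for which \<open>?d\<close> kills
    the value at \<open>P y\<close> form an ideal; it contains the generators \<open>B\<close>,
    hence all of \<open>?I\<close>.\<close>
  define J where "J = {P. \<exists>f. (P \<odot>\<^bsub>N\<^esub> y, f) \<in> G \<and> ?d \<odot>\<^bsub>E\<^esub> f = \<zero>\<^bsub>E\<^esub>}"
  have "is_ideal J"
    unfolding is_ideal_def
  proof (intro conjI ballI allI)
    show "0 \<in> J" using y partial_homD(3)[OF G] by (auto simp: J_def)
    fix P assume "P \<in> J"
    then obtain f where f: "(P \<odot>\<^bsub>N\<^esub> y, f) \<in> G" "?d \<odot>\<^bsub>E\<^esub> f = \<zero>\<^bsub>E\<^esub>" by (auto simp: J_def)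
    note fc = partial_homD(2)[OF G f(1)]
    show "R * P \<in> J" for R
      using partial_homD(5)[OF G f(1), of R] f(2) fc y E.act_commute[OF fc, of ?d R]
      by (auto simp: J_def N.act_mult intro!: exI[of _ "R \<odot>\<^bsub>E\<^esub> f"])
    fix Q assume "Q \<in> J"
    then obtain g where g: "(Q \<odot>\<^bsub>N\<^esub> y, g) \<in> G" "?d \<odot>\<^bsub>E\<^esub> g = \<zero>\<^bsub>E\<^esub>" by (auto simp: J_def)
    show "P + Q \<in> J"
      using partial_homD(4)[OF G f(1) g(1)] f(2) g(2) fc partial_homD(2)[OF G g(1)] y
      by (auto simp: J_def N.act_add_left E.act_add_right intro!: exI[of _ "f \<oplus>\<^bsub>E\<^esub> g"])
  qed
  moreover have "B \<subseteq> J"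
  proof
    fix P assume P: "P \<in> B"
    then obtain f where f: "(P \<odot>\<^bsub>N\<^esub> y, f) \<in> G" using B(1) by blast
    then show "P \<in> J" using rs(2)[OF P f] by (auto simp: J_def)
  qed
  ultimately have "?I \<subseteq> J" using B(3) by simp
  have "?d \<odot>\<^bsub>E\<^esub> f = \<zero>\<^bsub>E\<^esub>" if f: "(P \<odot>\<^bsub>N\<^esub> y, f) \<in> G" for P f
  proof -
    have "P \<in> J" using f \<open>?I \<subseteq> J\<close> by blast
    then obtain g where "(P \<odot>\<^bsub>N\<^esub> y, g) \<in> G" "?d \<odot>\<^bsub>E\<^esub> g = \<zero>\<^bsub>E\<^esub>" by (auto simp: J_def)
    then show ?thesis using partial_hom_unique[OF G f] by simp
  qed
  then show ?thesis using rs(1) by blast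
qed

context
  fixes G
  assumes G: "partial_hom G" and maximal: "\<And>G'. partial_hom G' \<Longrightarrow> G \<subseteq> G' \<Longrightarrow> G' = G"
begin

text \<open>Maximality turns each admissible extension by one element into membership in
  \<open>G\<close>.\<close>

lemma maximal_extend:
  assumes "y \<in> carrier N" "f0 \<in> carrier E" "\<And>P f. (P \<odot>\<^bsub>N\<^esub> y, f) \<in> G \<Longrightarrow> f = P \<odot>\<^bsub>E\<^esub> f0"
  shows "(y, f0) \<in> G"
proof -
  have "\<exists>G'. partial_hom G' \<and> G \<subseteq> G' \<and> (y, f0) \<in> G'"
    by (rule partial_hom_extend[OF G assms(1,2)]) (rule assms(3))
  then obtain G' where "partial_hom G'" "G \<subseteq> G'" "(y, f0) \<in> G'" by blast
  then show ?thesis using maximal[of G'] by simp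
qed

text \<open>The extension by zero to a high power of \<open>d\<close> is well defined, an elementary substitute
  for the Artin--Rees lemma.\<close>

lemma torsion_mod_domain:
  assumes y: "y \<in> carrier N"
  shows "\<exists>rs. set rs \<subseteq> S \<and> Dlin_prod j rs \<odot>\<^bsub>N\<^esub> y \<in> Domain G"
proof -
  obtain rs where rs: "set rs \<subseteq> S"
    "\<And>P f. (P \<odot>\<^bsub>N\<^esub> y, f) \<in> G \<Longrightarrow> Dlin_prod j rs \<odot>\<^bsub>E\<^esub> f = \<zero>\<^bsub>E\<^esub>"
    using values_uniformly_torsion[OF G y] by blast
  define d where "d = Dlin_prod j rs"
  obtain k where k: "\<And>P l. (P * d ^ l) \<odot>\<^bsub>N\<^esub> y \<in> Domain G \<Longrightarrow> (P * d ^ k) \<odot>\<^bsub>N\<^esub> y \<in> Domain G"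
    using ideal_quotient_stable[OF ideal_of_denominators[OF G y], of d] unfolding mem_Collect_eq by blast
  \<comment> \<open>One power beyond the stable exponent: if \<open>P * d ^ Suc k\<close> sends
    \<open>y\<close> into the domain, then so does \<open>P * d ^ k\<close>, with some value
    \<open>g\<close>, and the value in question is \<open>d\<close> applied to \<open>g\<close>,
    which is zero.\<close>
  have "(d ^ Suc k \<odot>\<^bsub>N\<^esub> y, \<zero>\<^bsub>E\<^esub>) \<in> G"
  proof (rule maximal_extend)
    fix P f assume f: "(P \<odot>\<^bsub>N\<^esub> (d ^ Suc k \<odot>\<^bsub>N\<^esub> y), f) \<in> G"
    then have "(P * d ^ Suc k) \<odot>\<^bsub>N\<^esub> y \<in> Domain G" using y by (auto simp: N.act_mult)
    from k[OF this] obtain g where g: "((P * d ^ k) \<odot>\<^bsub>N\<^esub> y, g) \<in> G" by blast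
    have "(d \<odot>\<^bsub>N\<^esub> ((P * d ^ k) \<odot>\<^bsub>N\<^esub> y), d \<odot>\<^bsub>E\<^esub> g) \<in> G"
      by (rule partial_homD(5)[OF G g])
    moreover have "d \<odot>\<^bsub>N\<^esub> ((P * d ^ k) \<odot>\<^bsub>N\<^esub> y) = P \<odot>\<^bsub>N\<^esub> (d ^ Suc k \<odot>\<^bsub>N\<^esub> y)"
      using y by (simp add: mult_ac flip: N.act_mult)
    ultimately have "f = d \<odot>\<^bsub>E\<^esub> g" using f partial_hom_unique[OF G] by simp
    then show "f = P \<odot>\<^bsub>E\<^esub> \<zero>\<^bsub>E\<^esub>" using rs(2)[OF g] by (simp add: d_def)
  qed (use y in auto)
  moreover obtain ss where "set ss \<subseteq> set rs" "d ^ Suc k = Dlin_prod j ss"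
    using Dlin_prod_power[of rs j "Suc k"] unfolding d_def by blast
  ultimately have "Dlin_prod j ss \<odot>\<^bsub>N\<^esub> y \<in> Domain G" "set ss \<subseteq> S" using rs(1) by auto
  then show ?thesis by blast
qed

lemma maximal_total: "Domain G = carrier N"
proof (rule ccontr)
  assume "Domain G \<noteq> carrier N"
  moreover have "Domain G \<subseteq> carrier N" using partial_homD(1)[OF G] by auto
  ultimately obtain y where y: "y \<in> carrier N" "y \<notin> Domain G" by blast
  obtain P a where P: "P \<odot>\<^bsub>N\<^esub> y \<notin> Domain G"
      and a: "\<And>j. a $ j \<in> S" "\<And>j. Dlin j (a $ j) \<odot>\<^bsub>N\<^esub> (P \<odot>\<^bsub>N\<^esub> y) \<in> Domain G"
    using N.ex_joint_eigenvector_mod[OF y, of S] torsion_mod_domain[OF y(1)] partial_homD(5)[OF G]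
    by blast
  define z where "z = P \<odot>\<^bsub>N\<^esub> y"
  have z: "z \<in> carrier N" "z \<notin> Domain G" using y P by (auto simp: z_def)
  have "\<exists>g. \<forall>j. (Dlin j (a $ j) \<odot>\<^bsub>N\<^esub> z, g j) \<in> G"
    using a(2) by (intro choice) (auto simp: z_def)
  then obtain g where g: "\<And>j. (Dlin j (a $ j) \<odot>\<^bsub>N\<^esub> z, g j) \<in> G" by blast
  \<comment> \<open>Both sides are values of \<open>G\<close> at the same element, since the two
    operators commute on \<open>z\<close>.\<close>
  have "Dlin i (a $ i) \<odot>\<^bsub>E\<^esub> g j = Dlin j (a $ j) \<odot>\<^bsub>E\<^esub> g i" for i j
    using partial_homD(5)[OF G g[of j], of "Dlin i (a $ i)"] partial_homD(5)[OF G g[of i], of "Dlin j (a $ j)"]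
      N.act_commute[OF z(1)] partial_hom_unique[OF G] by metis
  then obtain f0 where f0: "f0 \<in> carrier E" "\<And>j. Dlin j (a $ j) \<odot>\<^bsub>E\<^esub> f0 = g j"
    using solvable[of a g] a(1) partial_homD(2)[OF G g] by blast
  have Dvar: "Dvar j = Dlin j (a $ j) + Dconst (complex_of_real (a $ j))" for j
    by (simp add: Dlin_def)
  \<comment> \<open>Modulo the ideal generated by the \<open>Dlin j (a $ j)\<close> every operator
    is a constant \<open>c\<close>, its value at the point \<open>a\<close>; on that ideal
    \<open>f0\<close> reproduces the values of \<open>G\<close>.\<close>
  have reduce: "\<exists>c. ((P - Dconst c) \<odot>\<^bsub>N\<^esub> z, (P - Dconst c) \<odot>\<^bsub>E\<^esub> f0) \<in> G" for P
  proof (induction P rule: diff_op_induct)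
    case (const c)
    show ?case using z f0 partial_homD(3)[OF G] by (intro exI[of _ c]) simp
  next
    case (var j P)
    then obtain c where c: "((P - Dconst c) \<odot>\<^bsub>N\<^esub> z, (P - Dconst c) \<odot>\<^bsub>E\<^esub> f0) \<in> G" by blast
    have eq: "Dvar j * P - Dconst (complex_of_real (a $ j) * c) = Dvar j * (P - Dconst c) + Dconst c * Dlin j (a $ j)"
      by (simp add: Dvar Dconst_simps algebra_simps)
    have "(Dvar j \<odot>\<^bsub>N\<^esub> ((P - Dconst c) \<odot>\<^bsub>N\<^esub> z) \<oplus>\<^bsub>N\<^esub> Dconst c \<odot>\<^bsub>N\<^esub> (Dlin j (a $ j) \<odot>\<^bsub>N\<^esub> z),
        Dvar j \<odot>\<^bsub>E\<^esub> ((P - Dconst c) \<odot>\<^bsub>E\<^esub> f0) \<oplus>\<^bsub>E\<^esub> Dconst c \<odot>\<^bsub>E\<^esub> (Dlin j (a $ j) \<odot>\<^bsub>E\<^esub> f0)) \<in> G"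
      unfolding f0(2) by (intro partial_homD(4,5)[OF G] c g)
    then show ?case
      using z f0 eq by (intro exI[of _ "complex_of_real (a $ j) * c"])
        (simp add: N.act_add_left N.act_mult E.act_add_left E.act_mult)
  next
    case (add P R)
    then obtain c d where c: "((P - Dconst c) \<odot>\<^bsub>N\<^esub> z, (P - Dconst c) \<odot>\<^bsub>E\<^esub> f0) \<in> G"
      "((R - Dconst d) \<odot>\<^bsub>N\<^esub> z, (R - Dconst d) \<odot>\<^bsub>E\<^esub> f0) \<in> G" by blast
    have eq: "P + R - Dconst (c + d) = (P - Dconst c) + (R - Dconst d)"
      by (simp add: Dconst_simps)
    show ?case
      using partial_homD(4)[OF G c] z f0
      by (intro exI[of _ "c + d"]) (simp only: eq N.act_add_left E.act_add_left)
  qed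
  have "(z, f0) \<in> G"
  proof (rule maximal_extend[OF z(1) f0(1)])
    fix P f assume f: "(P \<odot>\<^bsub>N\<^esub> z, f) \<in> G"
    obtain c where c: "((P - Dconst c) \<odot>\<^bsub>N\<^esub> z, (P - Dconst c) \<odot>\<^bsub>E\<^esub> f0) \<in> G"
      using reduce by blast
    \<comment> \<open>Otherwise \<open>z\<close> would lie in the domain, being \<open>1 / c\<close>
      times the difference of \<open>P z\<close> and \<open>(P - Dconst c) z\<close>.\<close>
    have "c = 0"
    proof (rule ccontr)
      assume "c \<noteq> 0"
      have "(Dconst (1 / c) \<odot>\<^bsub>N\<^esub> (P \<odot>\<^bsub>N\<^esub> z \<oplus>\<^bsub>N\<^esub> (- 1) \<odot>\<^bsub>N\<^esub> ((P - Dconst c) \<odot>\<^bsub>N\<^esub> z)),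
          Dconst (1 / c) \<odot>\<^bsub>E\<^esub> (f \<oplus>\<^bsub>E\<^esub> (- 1) \<odot>\<^bsub>E\<^esub> ((P - Dconst c) \<odot>\<^bsub>E\<^esub> f0))) \<in> G"
        by (intro partial_homD(4,5)[OF G] f c)
      moreover have "Dconst (1 / c) \<odot>\<^bsub>N\<^esub> (P \<odot>\<^bsub>N\<^esub> z \<oplus>\<^bsub>N\<^esub> (- 1) \<odot>\<^bsub>N\<^esub> ((P - Dconst c) \<odot>\<^bsub>N\<^esub> z)) =
          (Dconst (1 / c) * (P + (- 1) * (P - Dconst c))) \<odot>\<^bsub>N\<^esub> z"
        using z by (simp only: N.act_mult N.act_add_left N.act_closed)
      moreover have "Dconst (1 / c) * (P + (- 1) * (P - Dconst c)) = 1"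
        using \<open>c \<noteq> 0\<close> Dconst_simps(4)[of "1 / c" c] by (simp add: Dconst_simps(2))
      ultimately show False using z by auto
    qed
    then have "(P \<odot>\<^bsub>N\<^esub> z, P \<odot>\<^bsub>E\<^esub> f0) \<in> G" using c by (simp add: Dconst_simps)
    then show "f = P \<odot>\<^bsub>E\<^esub> f0" by (rule partial_hom_unique[OF G f])
  qed
  then show False using z(2) by blast
qed

end

text \<open>The graph of \<open>g\<close> composed with the inverse of \<open>i\<close> is a partial
  homomorphism, the condition over zero being injectivity of \<open>i\<close>. A maximal extension
  is total and hence the graph of some \<open>h\<close>.\<close>

lemma extend_hom:
  assumes M: "diff_op_module M" and i: "i \<in> mod_homs diff_op_ring M N" "inj_on i (carrier M)"
    and g: "g \<in> mod_homs diff_op_ring M E"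
  shows "\<exists>h\<in>mod_homs diff_op_ring N E. \<forall>x\<in>carrier M. h (i x) = g x"
proof -
  interpret M: diff_op_module M by fact
  have ih: "\<And>x. x \<in> carrier M \<Longrightarrow> i x \<in> carrier N"
      "\<And>x y. x \<in> carrier M \<Longrightarrow> y \<in> carrier M \<Longrightarrow> i (x \<oplus>\<^bsub>M\<^esub> y) = i x \<oplus>\<^bsub>N\<^esub> i y"
      "\<And>P x. x \<in> carrier M \<Longrightarrow> i (P \<odot>\<^bsub>M\<^esub> x) = P \<odot>\<^bsub>N\<^esub> i x"
    and gh: "\<And>x. x \<in> carrier M \<Longrightarrow> g x \<in> carrier E"
      "\<And>x y. x \<in> carrier M \<Longrightarrow> y \<in> carrier M \<Longrightarrow> g (x \<oplus>\<^bsub>M\<^esub> y) = g x \<oplus>\<^bsub>E\<^esub> g y"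
      "\<And>P x. x \<in> carrier M \<Longrightarrow> g (P \<odot>\<^bsub>M\<^esub> x) = P \<odot>\<^bsub>E\<^esub> g x"
    using i(1) g by (auto simp: mod_homs_def hom_def diff_op_ring_def)
  have i0: "i \<zero>\<^bsub>M\<^esub> = \<zero>\<^bsub>N\<^esub>" and g0: "g \<zero>\<^bsub>M\<^esub> = \<zero>\<^bsub>E\<^esub>"
    using ih(1,3)[of "\<zero>\<^bsub>M\<^esub>" ] gh(1,3)[of "\<zero>\<^bsub>M\<^esub>"] by (metis M.M.zero_closed M.act_zero_right N.act_zero_left E.act_zero_left)+
  define G0 where "G0 = (\<lambda>x. (i x, g x)) ` carrier M"
  have G0I: "(i x, g x) \<in> G0" if "x \<in> carrier M" for x using that by (auto simp: G0_def)
  have "partial_hom G0"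
    unfolding partial_hom_def
  proof (intro conjI allI impI)
    show "G0 \<subseteq> carrier N \<times> carrier E" using ih gh by (auto simp: G0_def)
    show "(\<zero>\<^bsub>N\<^esub>, \<zero>\<^bsub>E\<^esub>) \<in> G0" using G0I[of "\<zero>\<^bsub>M\<^esub>"] by (simp add: i0 g0)
  next
    fix u f v k assume "(u, f) \<in> G0 \<and> (v, k) \<in> G0"
    then obtain x y where "x \<in> carrier M" "y \<in> carrier M" "u = i x" "f = g x" "v = i y" "k = g y"
      by (auto simp: G0_def)
    then show "(u \<oplus>\<^bsub>N\<^esub> v, f \<oplus>\<^bsub>E\<^esub> k) \<in> G0" using G0I[of "x \<oplus>\<^bsub>M\<^esub> y"] by (simp add: ih gh)
  next
    fix P u f assume "(u, f) \<in> G0"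
    then obtain x where "x \<in> carrier M" "u = i x" "f = g x" by (auto simp: G0_def)
    then show "(P \<odot>\<^bsub>N\<^esub> u, P \<odot>\<^bsub>E\<^esub> f) \<in> G0" using G0I[of "P \<odot>\<^bsub>M\<^esub> x"] by (simp add: ih gh)
  next
    fix f assume "(\<zero>\<^bsub>N\<^esub>, f) \<in> G0"
    then obtain x where x: "x \<in> carrier M" "i x = i \<zero>\<^bsub>M\<^esub>" "f = g x" by (auto simp: G0_def i0)
    then have "x = \<zero>\<^bsub>M\<^esub>" using i(2) by (auto dest: inj_onD)
    then show "f = \<zero>\<^bsub>E\<^esub>" using x g0 by simp
  qed
  from ex_maximal_partial_hom[OF this] obtain G
    where G: "partial_hom G" "G0 \<subseteq> G" "\<forall>G'. partial_hom G' \<longrightarrow> G \<subseteq> G' \<longrightarrow> G' = G"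
    by (elim exE conjE)
  have "\<exists>f. (u, f) \<in> G" if "u \<in> carrier N" for u
    using maximal_total[OF G(1) G(3)[rule_format]] that by blast
  then obtain h where h: "\<And>u. u \<in> carrier N \<Longrightarrow> (u, h u) \<in> G" by metis
  have hI: "h u = f" if "(u, f) \<in> G" for u f
    using partial_hom_unique[OF G(1) h that] partial_homD(1)[OF G(1) that] by blast
  have "h \<in> mod_homs diff_op_ring N E"
    unfolding mod_homs_def hom_def
    using partial_homD(2)[OF G(1) h] hI partial_homD(4,5)[OF G(1) h] h by auto
  moreover have "h (i x) = g x" if "x \<in> carrier M" for x
    using hI G0I[OF that] G(2) by blast
  ultimately show ?thesis by blast
qed

end

section \<open>Injectivity and essentiality\<close>

context frequencies
begin

section \<open>Finite exponential sums as a submodule\<close>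

lemma fin_exp_sums_zero: "(\<lambda>x. 0) \<in> fin_exp_sums \<Lambda>"
  unfolding fin_exp_sums_def by (intro CollectI exI[of _ "{}"]) auto

lemma fin_exp_sums_scale: "f \<in> fin_exp_sums \<Lambda> \<Longrightarrow> (\<lambda>x. c * f x) \<in> fin_exp_sums \<Lambda>"
  unfolding fin_exp_sums_def
proof clarify
  fix A d assume "finite A" "A \<subseteq> \<Lambda>"
  then show "\<exists>A' d'. finite A' \<and> A' \<subseteq> \<Lambda> \<and>
      (\<lambda>x. c * (\<Sum>a\<in>A. d a * exp (\<i> * complex_of_real (a \<bullet> x)))) =
      (\<lambda>x. \<Sum>a\<in>A'. d' a * exp (\<i> * complex_of_real (a \<bullet> x)))"
    by (intro exI[of _ A] exI[of _ "\<lambda>a. c * d a"]) (simp add: sum_distrib_left mult.assoc)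
qed

lemma fin_exp_sums_add:
  assumes "f \<in> fin_exp_sums \<Lambda>" "g \<in> fin_exp_sums \<Lambda>"
  shows "(\<lambda>x. f x + g x) \<in> fin_exp_sums \<Lambda>"
proof -
  let ?e = "\<lambda>a x. exp (\<i> * complex_of_real (a \<bullet> x))"
  obtain A c where A: "finite A" "A \<subseteq> \<Lambda>" "f = (\<lambda>x. \<Sum>a\<in>A. c a * ?e a x)"
    using assms(1) unfolding fin_exp_sums_def by blast
  obtain B d where B: "finite B" "B \<subseteq> \<Lambda>" "g = (\<lambda>x. \<Sum>a\<in>B. d a * ?e a x)"
    using assms(2) unfolding fin_exp_sums_def by blast
  have fA: "f x = (\<Sum>a\<in>A \<union> B. (if a \<in> A then c a else 0) * ?e a x)" for x
    unfolding A(3) using A B by (intro sum.mono_neutral_cong_left) auto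
  have gB: "g x = (\<Sum>a\<in>A \<union> B. (if a \<in> B then d a else 0) * ?e a x)" for x
    unfolding B(3) using A B by (intro sum.mono_neutral_cong_left) auto
  show ?thesis
    unfolding fin_exp_sums_def fA gB using A B
    by (intro CollectI exI[of _ "A \<union> B"]
        exI[of _ "\<lambda>a. (if a \<in> A then c a else 0) + (if a \<in> B then d a else 0)"])
      (auto simp: sum.distrib distrib_right)
qed

lemma fin_exp_sums_induct [consumes 1, case_names zero add]:
  assumes "f \<in> fin_exp_sums \<Lambda>" "Q (\<lambda>x. 0)"
    "\<And>a c f. a \<in> \<Lambda> \<Longrightarrow> f \<in> fin_exp_sums \<Lambda> \<Longrightarrow> Q f \<Longrightarrow> Q (\<lambda>x. c * character a x + f x)"
  shows "Q f"
proof -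
  obtain A c where A: "finite A" "A \<subseteq> \<Lambda>" "f = (\<lambda>x. \<Sum>a\<in>A. c a * character a x)"
    using assms(1) unfolding fin_exp_sums_def character_def by blast
  have "(\<lambda>x. \<Sum>a\<in>A. c a * character a x) \<in> fin_exp_sums \<Lambda> \<and> Q (\<lambda>x. \<Sum>a\<in>A. c a * character a x)"
    using A(1,2)
  proof (induction A rule: finite_induct)
    case (insert a A)
    moreover have "(\<lambda>x. \<Sum>a\<in>insert a A. c a * character a x) \<in> fin_exp_sums \<Lambda>"
      unfolding fin_exp_sums_def character_def using insert by blast
    ultimately show ?case using assms(3)[of a _ "c a"] by simp
  qed (use assms(2) fin_exp_sums_zero in auto)
  then show ?thesis using A(3) by simp
qed

lemma D_op_fin_exp_sums:
  assumes "f \<in> fin_exp_sums {a. \<forall>j. a $ j \<in> S}"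
  shows "D_op j f \<in> fin_exp_sums {a. \<forall>j. a $ j \<in> S}"
  using assms
proof (induction f rule: fin_exp_sums_induct)
  case zero
  show ?case by (simp add: D_op_const fin_exp_sums_zero)
next
  case (add a c f)
  have a: "character a \<in> exp_polys S" using add.hyps by (intro exp_polys.character) auto
  have f: "f \<in> exp_polys S" using add.hyps fin_exp_sums_subset_exp_polys by blast
  have "(\<lambda>x. (c * complex_of_real (a $ j)) * character a x) \<in> fin_exp_sums {a. \<forall>j. a $ j \<in> S}"
    using add.hyps by (intro character_in_fin_exp_sums) auto
  then show ?case
    unfolding D_op_exp_polys_add[OF exp_polys.scale[OF a] f] D_op_exp_polys_scale[OF a] D_op_character
    using add.IH by (intro fin_exp_sums_add) (simp_all add: mult.assoc)
qed

lemma D_act_fin_exp_sums: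
  assumes f: "f \<in> fin_exp_sums {a. \<forall>j. a $ j \<in> S}"
  shows "D_act P f \<in> fin_exp_sums {a. \<forall>j. a $ j \<in> S}"
proof (induction P rule: diff_op_induct)
  have E: "f \<in> exp_polys S" using f fin_exp_sums_subset_exp_polys by blast
  {
    case (const c)
    show ?case by (simp add: D_act_Dconst[OF zero E] fin_exp_sums_scale f)
  next
    case (var j P)
    then show ?case
      by (simp add: D_act_mult[OF zero E] D_act_Dvar[OF zero D_act_closed[OF zero E]] D_op_fin_exp_sums)
  next
    case (add P R)
    then show ?case by (simp add: D_act_add_left fin_exp_sums_add)
  }
qed

lemma smooth_submodule_simps:
  "carrier (smooth_submodule A) = A" "\<zero>\<^bsub>smooth_submodule A\<^esub> = (\<lambda>x. 0)"
  "f \<oplus>\<^bsub>smooth_submodule A\<^esub> g = (\<lambda>x. f x + g x)" "P \<odot>\<^bsub>smooth_submodule A\<^esub> f = D_act P f"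
  by (simp_all add: smooth_submodule_def smooth_module_def)

section \<open>The exponential polynomials as an injective envelope\<close>

lemma exp_polys_diff_op_module: "diff_op_module (smooth_submodule (exp_polys S))"
  unfolding diff_op_module_def by (rule exp_polys_module[OF zero])

lemma exp_polys_injective:
  "injective_module TYPE('b) TYPE('c) diff_op_ring
     (smooth_submodule (exp_polys S :: (real^'n \<Rightarrow> complex) set))"
  unfolding injective_module_def
proof (intro conjI allI impI)
  let ?E = "smooth_submodule (exp_polys S :: (real^'n \<Rightarrow> complex) set)"
  show "Module.module diff_op_ring ?E" by (rule exp_polys_module[OF zero])
  fix M :: "('n diff_op, 'b) module" and N :: "('n diff_op, 'c) module" and i g
  assume *: "Module.module diff_op_ring M \<and> Module.module diff_op_ring N \<and>
    i \<in> mod_homs diff_op_ring M N \<and> inj_on i (carrier M) \<and> g \<in> mod_homs diff_op_ring M ?E"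
  interpret N: diff_op_module N using * by (simp add: diff_op_module_def)
  interpret E: diff_op_module ?E by (rule exp_polys_diff_op_module)
  interpret torsion_divisible N ?E S
  proof unfold_locales
    show "\<exists>rs. set rs \<subseteq> S \<and> Dlin_prod j rs \<odot>\<^bsub>?E\<^esub> f = \<zero>\<^bsub>?E\<^esub>" if "f \<in> carrier ?E" for f j
      using exp_polys_torsion[of f j] that by (simp add: smooth_submodule_simps)
  next
    fix a :: "real^'n" and g
    assume "\<And>j. a $ j \<in> S" "\<And>j. g j \<in> carrier ?E"
      "\<And>i j. Dlin i (a $ i) \<odot>\<^bsub>?E\<^esub> g j = Dlin j (a $ j) \<odot>\<^bsub>?E\<^esub> g i"
    then show "\<exists>f\<in>carrier ?E. \<forall>j. Dlin j (a $ j) \<odot>\<^bsub>?E\<^esub> f = g j"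
      unfolding smooth_submodule_simps by (rule shifted_poincare)
  qed
  show "\<exists>h\<in>mod_homs diff_op_ring N ?E. \<forall>x\<in>carrier M. h (i x) = g x"
    using * by (intro extend_hom) (auto simp: diff_op_module_def)
qed

lemma fin_exp_sums_essential:
  "essential_submodule (fin_exp_sums {a :: real^'n. \<forall>j. a $ j \<in> S}) diff_op_ring
     (smooth_submodule (exp_polys S))"
  (is "essential_submodule ?N _ ?E")
  unfolding essential_submodule_def
proof (intro conjI allI impI)
  interpret E: diff_op_module ?E by (rule exp_polys_diff_op_module)
  show "submodule ?N diff_op_ring ?E"
  proof (rule E.submoduleI)
    fix f assume "f \<in> ?N"
    then have "(- 1) \<odot>\<^bsub>?E\<^esub> f \<in> ?N" by (simp add: smooth_submodule_simps D_act_fin_exp_sums)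
    moreover have "f \<in> carrier ?E"
      using \<open>f \<in> ?N\<close> fin_exp_sums_subset_exp_polys by (auto simp: smooth_submodule_simps)
    ultimately show "\<ominus>\<^bsub>?E\<^esub> f \<in> ?N" by (simp add: E.act_uminus)
  qed (use fin_exp_sums_subset_exp_polys in \<open>auto simp: smooth_submodule_simps fin_exp_sums_zero
      fin_exp_sums_add D_act_fin_exp_sums\<close>)
  fix L assume L: "submodule L diff_op_ring ?E \<and> L \<noteq> {\<zero>\<^bsub>?E\<^esub>}"
  note sub = E.submoduleE[OF conjunct1[OF L]]
  have act: "P \<odot>\<^bsub>?E\<^esub> f \<in> L" if "f \<in> L" for P f
    using sub(4)[of P f] that by (simp add: diff_op_ring_def)
  obtain f where "f \<in> L" using sub(2) by blast
  then have "\<zero>\<^bsub>?E\<^esub> \<in> L" using act[of f 0] sub(1) by auto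
  then obtain y where y: "y \<in> L" "y \<noteq> \<zero>\<^bsub>?E\<^esub>" using L by blast
  then have yE: "y \<in> exp_polys S" using sub(1) by (auto simp: smooth_submodule_simps)
  \<comment> \<open>Working modulo the zero submodule produces a nonzero multiple of
    \<open>y\<close> that is a joint eigenvector in the strict sense.\<close>
  have "\<exists>P a. P \<odot>\<^bsub>?E\<^esub> y \<notin> {\<zero>\<^bsub>?E\<^esub>} \<and> (\<forall>j. a $ j \<in> S \<and> Dlin j (a $ j) \<odot>\<^bsub>?E\<^esub> (P \<odot>\<^bsub>?E\<^esub> y) \<in> {\<zero>\<^bsub>?E\<^esub>})"
    using y yE exp_polys_torsion[OF yE]
    by (intro E.ex_joint_eigenvector_mod) (auto simp: smooth_submodule_simps D_act_zero_right)
  then obtain P a where Pa: "D_act P y \<noteq> (\<lambda>x. 0)" "\<And>j. a $ j \<in> S"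
      "\<And>j. D_act (Dlin j (a $ j)) (D_act P y) = (\<lambda>x. 0)"
    by (auto simp: smooth_submodule_simps)
  obtain c where "D_act P y = (\<lambda>x. c * character a x)"
    using joint_eigenfunction[OF D_act_closed[OF zero yE] Pa(2,3)] by blast
  then have "D_act P y \<in> ?N" using character_in_fin_exp_sums[OF Pa(2)] by simp
  moreover have "D_act P y \<in> L" using act[OF y(1), of P] by (simp add: smooth_submodule_simps)
  ultimately show "L \<inter> ?N \<noteq> {\<zero>\<^bsub>?E\<^esub>}" using Pa(1) by (auto simp: smooth_submodule_simps)
qed

lemma exp_polys_injective_envelope:
  "injective_envelope TYPE('b) TYPE('c) diff_op_ring
     (smooth_submodule (adjoin_coords (fin_exp_sums {a :: real^'n. \<forall>j. a $ j \<in> S})))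
     (fin_exp_sums {a. \<forall>j. a $ j \<in> S})"
  unfolding injective_envelope_def adjoin_coords_fin_exp_sums
  by (intro conjI exp_polys_injective fin_exp_sums_essential)

end

theorem proposition2p1:
  shows "injective_envelope TYPE('b) TYPE('c) diff_op_ring
           (smooth_submodule (adjoin_coords (PT_fin :: (real^'n \<Rightarrow> complex) set))) PT_fin
       \<and> injective_envelope TYPE('b) TYPE('c) diff_op_ring
           (smooth_submodule (adjoin_coords (T_fin :: (real^'n \<Rightarrow> complex) set))) T_fin"
proof -
  \<comment> \<open>The two claims are instances of one statement, for the additive subgroups
    \<open>\<rat>\<close> and \<open>\<int>\<close>.\<close>
  interpret Q: frequencies "\<rat>" by unfold_locales auto
  interpret Z: frequencies "\<int>" by unfold_locales auto
  show ?thesis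
    unfolding PT_fin_def T_fin_def
    by (intro conjI Q.exp_polys_injective_envelope Z.exp_polys_injective_envelope)
qed

end
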